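(* Let $M\le N$ and $h>0$. A candidate order $\mathbf{S}$ of $M$ transmitters and $N$ receivers is optimal if $$|n_{T_iT_{i+1}}-n_{T_jT_{j+1}}|\le 1\quad\text{for all } i\ne j,$$ $$|n_{T_iT_{i+1}}-2n_{H_lT_1}|\le1,\qquad |n_{T_iT_{i+1}}-2n_{T_MH_r}|\le 1\quad\text{for all } i.$$
   Context: All points lie on a line. There are $M$ transmitters (type $T$) and $N$ receivers (type $R$), $J=M+N$, and two virtual end nodes $H_l$ (leftmost) and $H_r$ (rightmost). A (deployment) order is a sequence $\mathbf{S}=(H_l,S_1,\dots,S_J,H_r)$ where $(S_1,\dots,S_J)$ is a permutation of the set of all transmitters and receivers, listed from left to right: $0\le\|H_lS_1\|\le\cdots\le\|H_lS_J\|\le\|H_lH_r\|$. Its spacings are the distances between neighbors, $\mathbf{D}_{\mathbf{S}}=(\|H_lS_1\|,\|S_1S_2\|,\dots,\|S_{J-1}S_J\|,\|S_JH_r\|)$. For a point $p$, $I(p)$ is the minimum of $\|T_ip\|\,\|R_jp\|$ over all transmitters $T_i$ and receivers $R_j$, and $Q(\overline{H_lH_r})=\max_{p\in\overline{H_lH_r}}I(p)$. An order $\mathbf{S}$ is optimal if, for some spacings with $\|H_lH_r\|=h$, it attains the minimum of $Q(\overline{H_lH_r})$ over all orders and all spacings satisfying $\|H_lH_r\|=h$. A candidate order is an order in which no block of consecutive nodes has (as sequence of node types) any of the patterns $(T,T,R,R)$, $(R,R,T,T)$, $(T,T,R,H_r)$, $(R,R,T,H_r)$, $(H_l,T,R,R)$,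 $(H_l,R,T,T)$. Transmitters are indexed in their left-to-right order $T_1,\dots,T_M$ in $\mathbf{S}$; $n_{H_lT_1}$, $n_{T_iT_{i+1}}$ (for $i=1,\dots,M-1$), $n_{T_MH_r}$ denote the number of receivers in the order $\mathbf{S}$ between $H_l$ and $T_1$, between $T_i$ and $T_{i+1}$, and between $T_M$ and $H_r$, respectively. In the conditions, the indices $i,j$ range over all values for which these quantities are defined.
   Formalization: It is assumed that M ≥ 1 (otherwise I(p) is undefined) and, for M = 1 only, that |n_{H_lT_1} − n_{T_MH_r}| ≤ 1: there the printed conditions are vacuous and the claim fails, e.g. for (H_l,R,R,R,T,R,H_r). *)

theory Defs
  imports Complex_Main "HOL-Library.Sublist"
begin

text \<open>
  Nodes on a line: the virtual end nodes \<open>Hl\<close> and \<open>Hr\<close>, transmitters and receivers. The numbers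
  carried by transmitters and receivers only tell nodes of the same type apart; they are unrelated
  to the left-to-right numbering of the transmitters in an order.
\<close>

datatype node = Hl | Hr | Transmitter nat | Receiver nat

datatype node_type = HL | HR | TX | RX

fun type_of :: "node \<Rightarrow> node_type" where
  "type_of Hl = HL"
| "type_of Hr = HR"
| "type_of (Transmitter k) = TX"
| "type_of (Receiver k) = RX"

definition deployment_order :: "nat \<Rightarrow> nat \<Rightarrow> node list \<Rightarrow> bool" where
  "deployment_order M N S \<longleftrightarrow>
     (\<exists>ss. S = Hl # ss @ [Hr] \<and> distinct ss \<and> set ss = Transmitter ` {1..M} \<union> Receiver ` {1..N})"

text \<open>
  Neighbouring nodes may coincide, so spacings may be zero.
\<close>

definition spacings :: "node list \<Rightarrow> real \<Rightarrow> real list \<Rightarrow> bool" where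
  "spacings S h D \<longleftrightarrow> length D = length S - 1 \<and> (\<forall>d \<in> set D. 0 \<le> d) \<and> sum_list D = h"

text \<open>
  Coordinate of the node \<open>S ! k\<close> when the line is parametrised so that \<open>Hl\<close> sits at 0;
  the segment from \<open>Hl\<close> to \<open>Hr\<close> is then \<open>{0..sum_list D}\<close>.
\<close>

definition pos :: "real list \<Rightarrow> nat \<Rightarrow> real" where
  "pos D k = sum_list (take k D)"

definition I :: "node list \<Rightarrow> real list \<Rightarrow> real \<Rightarrow> real" where
  "I S D p = Min {\<bar>pos D i - p\<bar> * \<bar>pos D j - p\<bar> | i j.
     i < length S \<and> j < length S \<and> type_of (S ! i) = TX \<and> type_of (S ! j) = RX}"

text \<open>
  With at least one transmitter and one receiver, \<open>I S D\<close> is continuous, so this supremum over a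
  compact segment is a maximum.
\<close>

definition Q :: "node list \<Rightarrow> real list \<Rightarrow> real" where
  "Q S D = (SUP p \<in> {0..sum_list D}. I S D p)"

definition optimal_order :: "nat \<Rightarrow> nat \<Rightarrow> real \<Rightarrow> node list \<Rightarrow> bool" where
  "optimal_order M N h S \<longleftrightarrow> deployment_order M N S \<and>
     (\<exists>D. spacings S h D \<and>
        (\<forall>S' D'. deployment_order M N S' \<and> spacings S' h D' \<longrightarrow> Q S D \<le> Q S' D'))"

definition forbidden_patterns :: "node_type list set" where
  "forbidden_patterns =
     {[TX, TX, RX, RX], [RX, RX, TX, TX], [TX, TX, RX, HR],
      [RX, RX, TX, HR], [HL, TX, RX, RX], [HL, RX, TX, TX]}"

definition candidate_order :: "nat \<Rightarrow> nat \<Rightarrow> node list \<Rightarrow> bool" where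
  "candidate_order M N S \<longleftrightarrow> deployment_order M N S \<and>
     (\<forall>P \<in> forbidden_patterns. \<not> sublist P (map type_of S))"

text \<open>
  Index in \<open>S\<close> of the \<open>i\<close>-th transmitter from the left, counting from 1.
\<close>

definition tx_index :: "node list \<Rightarrow> nat \<Rightarrow> nat" where
  "tx_index S i = filter (\<lambda>k. type_of (S ! k) = TX) [0..<length S] ! (i - 1)"

definition receivers_between :: "node list \<Rightarrow> nat \<Rightarrow> nat \<Rightarrow> nat" where
  "receivers_between S a b = card {k. a < k \<and> k < b \<and> type_of (S ! k) = RX}"

definition n_first :: "node list \<Rightarrow> nat" where
  "n_first S = receivers_between S 0 (tx_index S 1)"

definition n_mid :: "node list \<Rightarrow> nat \<Rightarrow> nat" where
  "n_mid S i = receivers_between S (tx_index S i) (tx_index S (i + 1))"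

definition n_last :: "nat \<Rightarrow> node list \<Rightarrow> nat" where
  "n_last M S = receivers_between S (tx_index S M) (length S - 1)"

end

theory Submission
  imports Defs
begin

text \<open>
  Rescale so that the prescribed value of \<open>Q\<close> is 1; the question becomes how long a segment can be
  covered. Cut the line at the transmitters. If two neighbouring receivers (or the transmitter
  and the receiver next to it) are at distances \<open>y < x\<close> from the nearest transmitter, coverage of their midpoint
  says \<open>x\<^sup>2 \<le> y\<^sup>2 + 4\<close>, so the \<open>k\<close>-th receiver is at distance at most \<open>2 * sqrt k\<close>. Hence a zone
  between two transmitters containing \<open>n\<close> receivers has length at most \<open>zone_len n\<close>, and an end zone
  at most \<open>end_len n\<close>, whatever the order of the nodes. Both functions are concave, and for balanced
  counts a common slope \<open>c\<close> is tangent to all of them at once, so balanced counts maximise the total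
  length. The bounds are attained when every zone contains a receiver.

  The only balanced orders with a zone free of receivers are the alternating ones, where \<open>M = N\<close> and
  the bound is not attained. There the roles of transmitters and receivers are exchanged if necessary:
  if both end zones of one type are nonempty the concave bound is already sharp, and otherwise it
  suffices unless the nodes alternate, a case which is settled directly.
\<close>

section \<open>Length of a zone between neighbouring transmitters\<close>

text \<open>The last of \<open>n\<close> receivers, at \<open>2 * sqrt n\<close>, plus
  \<open>sqrt (n + 1) - sqrt n\<close>, half of what would be the next spacing.\<close>

definition end_len :: "nat \<Rightarrow> real" where
  "end_len n = sqrt n + sqrt (n + 1)"

text \<open>The \<open>n + 1\<close> spacings are split as evenly as possible between the two
  transmitters; \<open>j\<close> of them counted from a transmitter span \<open>2 * sqrt j\<close>
  in the extremal layout.\<close>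

definition zone_len :: "nat \<Rightarrow> real" where
  "zone_len n = 2 * (sqrt ((n + 1) div 2) + sqrt (n div 2 + 1))"

lemma end_len_mono: "m \<le> n \<Longrightarrow> end_len m \<le> end_len n"
  by (auto simp: end_len_def intro!: add_mono)

lemma zone_len_mono: "m \<le> n \<Longrightarrow> zone_len m \<le> zone_len n"
  by (auto simp: zone_len_def intro!: add_mono div_le_mono real_sqrt_le_mono)

text \<open>Two integers of fixed sum have the largest product when they differ by at most
  one.\<close>

lemma mult_le_balanced:
  fixes k l m :: nat
  assumes "k + l \<le> m + 1"
  shows "k * l \<le> ((m + 1) div 2) * (m div 2 + 1)"
proof -
  \<comment> \<open>Raising \<open>k\<close> until the sum is exactly \<open>m + 1\<close> only
    enlarges the product. The subtraction does not truncate, since \<open>l\<close> is at most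
    \<open>m + 1\<close>.\<close>
  define k' where "k' = m + 1 - l"
  have k': "k \<le> k'" "int k' = int m + 1 - int l"
    using assms by (auto simp: k'_def)
  obtain q where q: "m = 2 * q \<or> m = 2 * q + 1"
    by (metis oddE evenE)
  have "int k' * int l \<le> int ((m + 1) div 2) * int (m div 2 + 1)"
    using q
  proof
    assume m: "m = 2 * q"
    \<comment> \<open>Consecutive integers never have opposite signs; this product is the difference
      of the two sides.\<close>
    have "(int q - int l) * (int q + 1 - int l) \<ge> 0"
      by (cases "int q \<ge> int l") (auto intro: mult_nonneg_nonneg mult_nonpos_nonpos)
    moreover have "int k' * int l = (2 * int q + 1 - int l) * int l" using k'(2) m by simp
    ultimately show ?thesis using m by (simp add: algebra_simps)
  next
    assume m: "m = 2 * q + 1"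
    have "(int q + 1 - int l) * (int q + 1 - int l) \<ge> 0" by simp
    moreover have "int k' * int l = (2 * int q + 2 - int l) * int l" using k'(2) m by simp
    ultimately show ?thesis using m by (simp add: algebra_simps)
  qed
  then have "k' * l \<le> ((m + 1) div 2) * (m div 2 + 1)"
    by (metis of_nat_le_iff of_nat_mult)
  with k'(1) show ?thesis by (meson mult_le_mono1 le_trans)
qed

text \<open>After squaring, only the sum and the product of the arguments matter, and both are
  largest for the balanced split.\<close>

lemma sqrt_add_sqrt_le_zone_len:
  assumes "k + l \<le> m + 1"
  shows "2 * sqrt (real k) + 2 * sqrt (real l) \<le> zone_len m"
proof -
  define a b where "a = (m + 1) div 2" and "b = m div 2 + 1"
  have ab: "a + b = m + 1" by (auto simp: a_def b_def)
  have "k * l \<le> a * b"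
    using mult_le_balanced[OF assms] by (simp add: a_def b_def)
  then have "sqrt (real k * real l) \<le> sqrt (real a * real b)"
    by (metis of_nat_le_iff of_nat_mult real_sqrt_le_iff)
  moreover have "real k + real l \<le> real a + real b" using ab assms by linarith
  ultimately have "(sqrt k + sqrt l)\<^sup>2 \<le> (sqrt a + sqrt b)\<^sup>2"
    by (simp add: power2_sum real_sqrt_mult)
  then have "sqrt k + sqrt l \<le> sqrt a + sqrt b"
    by (rule power2_le_imp_le) simp
  then show ?thesis by (simp add: zone_len_def a_def b_def add.commute)
qed

text \<open>The transmitter is at 0. Passing from one receiver to the next adds at most 4 to the
  squared distance; inserting 0 gives this recursion its starting point.\<close>

lemma receiver_le_sqrt_card:
  fixes R :: "real set"
  assumes "finite R" and cover: "\<And>p. 0 \<le> p \<Longrightarrow> p \<le> L \<Longrightarrow> \<exists>r\<in>R. p * \<bar>p - r\<bar> \<le> 1"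
    and "x \<in> insert 0 R" "0 \<le> x" "x \<le> L"
  shows "x \<le> 2 * sqrt (card (R \<inter> {0<..x}))"
  using assms(3-5)
proof (induction "card (R \<inter> {0<..x})" arbitrary: x rule: less_induct)
  case less
  show ?case
  proof (cases "x = 0")
    case True
    then show ?thesis by simp
  next
    case False
    with less.prems have x: "x \<in> R" "0 < x" by auto
    define B where "B = R \<inter> {0<..<x}"
    define y where "y = Max (insert 0 B)"
    have finB: "finite B" using \<open>finite R\<close> by (simp add: B_def)
    have y: "y \<in> insert 0 B" unfolding y_def by (rule Max_in) (use finB in auto)
    have y0: "0 \<le> y" and ymax: "\<And>r. r \<in> B \<Longrightarrow> r \<le> y"
      unfolding y_def by (rule Max_ge; use finB in simp)+
    have yx: "y < x" using y x by (auto simp: B_def)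
    have "insert x (R \<inter> {0<..y}) \<subseteq> R \<inter> {0<..x}" using x yx by auto
    from card_mono[OF _ this] have cardle: "card (R \<inter> {0<..y}) + 1 \<le> card (R \<inter> {0<..x})"
      using \<open>finite R\<close> yx by (simp add: card_insert_if)
    have "y \<le> 2 * sqrt (card (R \<inter> {0<..y}))"
    proof (rule less.hyps)
      show "card (R \<inter> {0<..y}) < card (R \<inter> {0<..x})" using cardle by simp
      show "y \<in> insert 0 R" using y by (auto simp: B_def)
      show "0 \<le> y" "y \<le> L" using y0 yx less.prems by auto
    qed
    then have ysq: "y\<^sup>2 \<le> 4 * card (R \<inter> {0<..y})"
      using power_mono[OF _ y0, of "2 * sqrt (card (R \<inter> {0<..y}))" 2]
      by (simp add: power_mult_distrib)
    define p where "p = (x + y) / 2"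
    have p: "0 \<le> p" "p \<le> L" using y0 yx x less.prems by (auto simp: p_def)
    obtain r where r: "r \<in> R" "p * \<bar>p - r\<bar> \<le> 1" using cover[OF p] by blast
    have "(x - y) / 2 \<le> \<bar>p - r\<bar>"
    proof -
      \<comment> \<open>A receiver on the other side of the transmitter does not help: its distance
        to \<open>p\<close> is at least \<open>p\<close>, which is at least
        \<open>(x - y) / 2\<close>.\<close>
      consider "r \<le> 0" | "r \<in> B" | "x \<le> r" using r by (force simp: B_def)
      then show ?thesis
      proof cases
        case 2
        then have "(x - y) / 2 \<le> p - r" using ymax[of r] by (simp add: p_def field_simps)
        then show ?thesis by linarith
      qed (use y0 yx in \<open>auto simp: p_def field_simps\<close>)
    qed
    from mult_left_mono[OF this p(1)] r have "p * ((x - y) / 2) \<le> 1" by linarith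
    then have "x\<^sup>2 \<le> y\<^sup>2 + 4" by (simp add: p_def power2_eq_square field_simps)
    with ysq cardle have "x\<^sup>2 \<le> 4 * card (R \<inter> {0<..x})" by linarith
    then have "x \<le> sqrt (4 * card (R \<inter> {0<..x}))" by (rule real_le_rsqrt)
    then show ?thesis by (simp add: real_sqrt_mult)
  qed
qed

text \<open>Two constraints combine: the last receiver \<open>a\<close> obeys
  \<open>a \<le> 2 * sqrt k\<close>, and coverage of the far end gives
  \<open>L * (L - a) \<le> 1\<close>, where the square can be completed.\<close>

lemma segment_le_end_len:
  fixes R :: "real set"
  assumes "finite R" and cover: "\<And>p. 0 \<le> p \<Longrightarrow> p \<le> L \<Longrightarrow> \<exists>r\<in>R. p * \<bar>p - r\<bar> \<le> 1"
    and "0 \<le> L" and RL: "R \<subseteq> {..L}"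
  shows "L \<le> end_len (card (R \<inter> {0<..L}))"
proof -
  define a where "a = Max (insert 0 (R \<inter> {0<..}))"
  have a: "a \<in> insert 0 (R \<inter> {0<..})"
    unfolding a_def by (rule Max_in) (use \<open>finite R\<close> in auto)
  then have a0: "0 \<le> a" by auto
  have amax: "r \<le> a" if "r \<in> R \<inter> {0<..}" for r
    unfolding a_def by (rule Max_ge) (use \<open>finite R\<close> that in auto)
  have aL: "a \<le> L" using a RL \<open>0 \<le> L\<close> by auto
  define k where "k = card (R \<inter> {0<..L})"
  have "a \<le> 2 * sqrt (card (R \<inter> {0<..a}))"
    by (rule receiver_le_sqrt_card[OF \<open>finite R\<close> cover _ _ aL]) (use a in auto)
  also have "\<dots> \<le> 2 * sqrt k"
    using aL \<open>finite R\<close> by (auto simp: k_def intro!: card_mono)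
  finally have ak: "a \<le> 2 * sqrt k" .
  obtain r where r: "r \<in> R" "L * \<bar>L - r\<bar> \<le> 1" using cover[of L] \<open>0 \<le> L\<close> by blast
  have "r \<le> a" using amax[of r] r a0 by (cases "0 < r") auto
  then have "L * (L - a) \<le> L * \<bar>L - r\<bar>" using \<open>0 \<le> L\<close> by (intro mult_left_mono) auto
  with r have "(L - a / 2)\<^sup>2 \<le> 1 + (a / 2)\<^sup>2"
    by (simp add: power2_eq_square field_simps)
  also have "(a / 2)\<^sup>2 \<le> (sqrt k)\<^sup>2" using ak a0 by (intro power_mono) auto
  finally have "L - a / 2 \<le> sqrt (1 + k)" by (intro real_le_rsqrt) simp
  with ak show ?thesis by (simp add: end_len_def k_def add.commute)
qed

text \<open>Transmitters sit at 0 and \<open>Z\<close>. Each half is treated as with one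
  transmitter, the right half after a reflection; the stretch between the two innermost receivers is
  then bounded through its midpoint.\<close>

lemma segment_le_zone_len:
  fixes R :: "real set"
  assumes "finite R"
    and cover: "\<And>p. 0 \<le> p \<Longrightarrow> p \<le> Z \<Longrightarrow> \<exists>r\<in>R. min p (Z - p) * \<bar>p - r\<bar> \<le> 1"
    and "0 \<le> Z"
  shows "Z \<le> zone_len (card (R \<inter> {0<..<Z}))"
proof (cases "Z = 0")
  case True
  then show ?thesis by (simp add: zone_len_def)
next
  case False
  with \<open>0 \<le> Z\<close> have Z: "0 < Z" by simp
  \<comment> \<open>In a half without receivers the transmitter itself takes the place of the
    missing one: 0 on the left, \<open>Z\<close> on the right.\<close>
  define a where "a = Max (insert 0 (R \<inter> {0<..Z/2}))"
  define b where "b = Min (insert Z (R \<inter> {Z/2<..<Z}))"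
  have a: "a \<in> insert 0 (R \<inter> {0<..Z/2})"
    unfolding a_def by (rule Max_in) (use \<open>finite R\<close> in auto)
  then have a0: "0 \<le> a" by auto
  have amax: "r \<le> a" if "r \<in> R \<inter> {0<..Z/2}" for r
    unfolding a_def by (rule Max_ge) (use \<open>finite R\<close> that in auto)
  have b: "b \<in> insert Z (R \<inter> {Z/2<..<Z})"
    unfolding b_def by (rule Min_in) (use \<open>finite R\<close> in auto)
  then have bZ: "b \<le> Z" by auto
  have bmin: "b \<le> r" if "r \<in> R \<inter> {Z/2<..<Z}" for r
    unfolding b_def by (rule Min_le) (use \<open>finite R\<close> that in auto)
  have ab: "a \<le> Z / 2" "Z / 2 < b" using a b Z by auto
  define k l where "k = card (R \<inter> {0<..a})" and "l = card (R \<inter> {b..<Z})"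
  have coverl: "\<exists>r\<in>R. p * \<bar>p - r\<bar> \<le> 1" if "0 \<le> p" "p \<le> Z / 2" for p
    using cover[of p] that by (auto simp: min_def)
  have ak: "a \<le> 2 * sqrt k" unfolding k_def
    by (rule receiver_le_sqrt_card[OF \<open>finite R\<close> coverl _ _ ab(1)]) (use a in auto)
  let ?R = "(\<lambda>r. Z - r) ` R"
  have coverr: "\<exists>r\<in>?R. p * \<bar>p - r\<bar> \<le> 1" if "0 \<le> p" "p \<le> Z / 2" for p
  proof -
    have "\<exists>r\<in>R. min (Z - p) p * \<bar>Z - p - r\<bar> \<le> 1"
      using cover[of "Z - p"] that Z by simp
    then obtain r where r: "r \<in> R" "min (Z - p) p * \<bar>Z - p - r\<bar> \<le> 1" by blast
    then have "p * \<bar>p - (Z - r)\<bar> \<le> 1" using that by (simp add: min_def abs_minus_commute algebra_simps split: if_splits)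
    then show ?thesis using r by blast
  qed
  have "Z - b \<le> 2 * sqrt (card (?R \<inter> {0<..Z - b}))"
    by (rule receiver_le_sqrt_card[where L = "Z / 2"]) (use \<open>finite R\<close> coverr ab b bZ in auto)
  also have "?R \<inter> {0<..Z - b} = (\<lambda>r. Z - r) ` (R \<inter> {b..<Z})" by auto
  also have "card \<dots> = l" unfolding l_def by (rule card_image) (auto simp: inj_on_def)
  finally have bl: "Z - b \<le> 2 * sqrt l" .
  have "k + l = card (R \<inter> {0<..a} \<union> R \<inter> {b..<Z})"
    unfolding k_def l_def using \<open>finite R\<close> ab by (subst card_Un_disjoint) auto
  also have "\<dots> \<le> card (R \<inter> {0<..<Z})"
    by (rule card_mono) (use \<open>finite R\<close> ab Z in auto)
  finally have kl: "k + l \<le> card (R \<inter> {0<..<Z})" .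
  define p where "p = (a + b) / 2"
  have p: "0 \<le> p" "p \<le> Z" using a0 bZ ab by (auto simp: p_def)
  obtain r where r: "r \<in> R" "min p (Z - p) * \<bar>p - r\<bar> \<le> 1" using cover[OF p] by blast
  have pr: "(b - a) / 2 \<le> \<bar>p - r\<bar>"
  proof -
    consider "r \<le> 0" | "r \<in> R \<inter> {0<..Z/2}" | "r \<in> R \<inter> {Z/2<..<Z}" | "Z \<le> r"
      using r by force
    then show ?thesis
    proof cases
      case 2
      then have "(b - a) / 2 \<le> p - r" using amax[of r] by (simp add: p_def field_simps)
      then show ?thesis by linarith
    next
      case 3
      then have "(b - a) / 2 \<le> r - p" using bmin[of r] by (simp add: p_def field_simps)
      then show ?thesis by linarith
    qed (use a0 bZ ab in \<open>auto simp: p_def field_simps\<close>)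
  qed
  from mult_left_mono[OF this, of "min p (Z - p)"] r p
  have mid: "min p (Z - p) * ((b - a) / 2) \<le> 1" by linarith
  have asq: "a\<^sup>2 \<le> 4 * k" using power_mono[OF ak a0, of 2] by (simp add: power_mult_distrib)
  have bsq: "(Z - b)\<^sup>2 \<le> 4 * l"
    using power_mono[OF bl, of 2] bZ by (simp add: power_mult_distrib)
  \<comment> \<open>The transmitter nearer to the midpoint \<open>p\<close> gains one spacing: if
    that is 0, then \<open>b \<le> 2 * sqrt (k + 1)\<close>, as for one more receiver. Only one side
    gains, so the arguments of the roots add up to at most the count plus one.\<close>
  show ?thesis
  proof (cases "p \<le> Z / 2")
    case True
    then have "p * ((b - a) / 2) \<le> 1" using mid by (simp add: min_def split: if_splits)
    then have "b\<^sup>2 \<le> 4 * real (k + 1)" using asq by (simp add: p_def power2_eq_square field_simps)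
    then have "b \<le> sqrt (4 * real (k + 1))" by (rule real_le_rsqrt)
    then have "b \<le> 2 * sqrt (k + 1)" using real_sqrt_mult[of 4 "real (k + 1)"] by simp
    then have "Z \<le> 2 * sqrt (real (k + 1)) + 2 * sqrt l" using bl by simp
    also have "\<dots> \<le> zone_len (card (R \<inter> {0<..<Z}))"
      by (rule sqrt_add_sqrt_le_zone_len) (use kl in simp)
    finally show ?thesis .
  next
    case False
    then have "(Z - p) * ((b - a) / 2) \<le> 1" using mid by (simp add: min_def split: if_splits)
    then have "(Z - a)\<^sup>2 \<le> 4 * real (l + 1)"
      using bsq by (simp add: p_def power2_eq_square field_simps)
    then have "Z - a \<le> sqrt (4 * real (l + 1))" by (rule real_le_rsqrt)
    then have "Z - a \<le> 2 * sqrt (l + 1)" using real_sqrt_mult[of 4 "real (l + 1)"] by simp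
    then have "Z \<le> 2 * sqrt k + 2 * sqrt (real (l + 1))" using ak by simp
    also have "\<dots> \<le> zone_len (card (R \<inter> {0<..<Z}))"
      by (rule sqrt_add_sqrt_le_zone_len) (use kl in simp)
    finally show ?thesis .
  qed
qed

section \<open>Coverings of a segment and their zones\<close>

definition covered :: "real list \<Rightarrow> real list \<Rightarrow> real \<Rightarrow> bool" where
  "covered ts rs h \<longleftrightarrow> (\<forall>p\<in>{0..h}. \<exists>t\<in>set ts. \<exists>r\<in>set rs. \<bar>p - t\<bar> * \<bar>p - r\<bar> \<le> 1)"

definition covering :: "real list \<Rightarrow> real list \<Rightarrow> real \<Rightarrow> bool" where
  "covering ts rs h \<longleftrightarrow> sorted ts \<and> sorted rs \<and> set ts \<union> set rs \<subseteq> {0..h} \<and> covered ts rs h"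

lemma covering_commute: "covering ts rs h \<Longrightarrow> covering rs ts h"
  unfolding covering_def covered_def by (metis Un_commute mult.commute)

lemma covering_nth:
  assumes "covering ts rs h" "i < length ts"
  shows "0 \<le> ts ! i" "ts ! i \<le> h"
  using assms nth_mem[of i ts] by (auto simp: covering_def simp del: nth_mem)

text \<open>
  The zones are half-open, so that receivers sharing a position with a transmitter are counted once.
\<close>

definition zone_count :: "real list \<Rightarrow> real list \<Rightarrow> nat \<Rightarrow> nat" where
  "zone_count ts rs i =
     length (filter (\<lambda>r. (i = 0 \<or> ts ! (i - 1) \<le> r) \<and> (i = length ts \<or> r < ts ! i)) rs)"

lemma length_filter_split:
  "(\<And>x. P x \<longleftrightarrow> P1 x \<or> P2 x) \<Longrightarrow> (\<And>x. \<not> (P1 x \<and> P2 x)) \<Longrightarrow>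
   length (filter P xs) = length (filter P1 xs) + length (filter P2 xs)"
  by (induction xs) auto

lemma sum_zone_count_less:
  assumes "sorted ts" "m < length ts"
  shows "(\<Sum>i\<le>m. zone_count ts rs i) = length (filter (\<lambda>r. r < ts ! m) rs)"
  using assms(2)
proof (induction m)
  case 0
  then show ?case by (auto simp: zone_count_def intro!: arg_cong[where f = length] filter_cong)
next
  case (Suc m)
  then have "ts ! m \<le> ts ! Suc m" using assms by (simp add: sorted_nth_mono)
  then have "length (filter (\<lambda>r. r < ts ! Suc m) rs) =
    length (filter (\<lambda>r. r < ts ! m) rs) + length (filter (\<lambda>r. ts ! m \<le> r \<and> r < ts ! Suc m) rs)"
    by (intro length_filter_split) auto
  then show ?case using Suc by (simp add: zone_count_def)
qed

lemma sum_zone_count: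
  assumes "sorted ts" "ts \<noteq> []"
  shows "(\<Sum>i\<le>length ts. zone_count ts rs i) = length rs"
proof -
  obtain m where m: "length ts = Suc m" using assms by (cases ts) auto
  have "length (filter (\<lambda>_. True) rs) =
    length (filter (\<lambda>r. r < ts ! m) rs) + length (filter (\<lambda>r. ts ! m \<le> r) rs)"
    by (intro length_filter_split) auto
  then show ?thesis
    using sum_zone_count_less[OF assms(1), of m rs] m by (simp add: zone_count_def)
qed

text \<open>Coinciding receivers merge in a set of positions but are counted separately in the
  list.\<close>

lemma card_le_length_filter:
  assumes "finite A" "A \<subseteq> f ` {x \<in> set xs. P x}"
  shows "card A \<le> length (filter P xs)"
proof -
  have "card A \<le> card (f ` set (filter P xs))" using assms by (intro card_mono) auto
  also have "\<dots> \<le> length (filter P xs)" using card_image_le card_length le_trans by blast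
  finally show ?thesis .
qed

text \<open>A reflection moves the first transmitter to 0. For points to its left no other
  transmitter is closer, so coverage is coverage by this one.\<close>

lemma first_zone_le:
  assumes "covering ts rs h" "ts \<noteq> []"
  shows "ts ! 0 \<le> end_len (zone_count ts rs 0)"
proof -
  let ?R = "(\<lambda>r. ts ! 0 - r) ` set rs"
  have t0: "0 \<le> ts ! 0" "ts ! 0 \<le> h" and rs: "set rs \<subseteq> {0..h}"
    using assms covering_nth[of ts rs h 0] by (auto simp: covering_def)
  have t0_le: "ts ! 0 \<le> t" if "t \<in> set ts" for t
    using assms that by (auto simp: covering_def in_set_conv_nth sorted_nth_mono)
  have "ts ! 0 \<le> end_len (card (?R \<inter> {0<..ts ! 0}))"
  proof (rule segment_le_end_len)
    fix p assume p: "0 \<le> p" "p \<le> ts ! 0"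
    obtain t r where tr: "t \<in> set ts" "r \<in> set rs" "\<bar>ts ! 0 - p - t\<bar> * \<bar>ts ! 0 - p - r\<bar> \<le> 1"
      using assms p t0 unfolding covering_def covered_def
      by (metis atLeastAtMost_iff diff_ge_0_iff_ge diff_left_mono diff_zero dual_order.trans)
    have "p * \<bar>ts ! 0 - p - r\<bar> \<le> \<bar>ts ! 0 - p - t\<bar> * \<bar>ts ! 0 - p - r\<bar>"
      using t0_le[OF tr(1)] p by (intro mult_right_mono) auto
    with tr have "p * \<bar>p - (ts ! 0 - r)\<bar> \<le> 1" by (simp add: abs_minus_commute algebra_simps)
    then show "\<exists>r\<in>?R. p * \<bar>p - r\<bar> \<le> 1" using tr(2) by blast
  qed (use t0 rs in auto)
  also have "\<dots> \<le> end_len (zone_count ts rs 0)"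
    unfolding zone_count_def using assms(2)
    by (intro end_len_mono card_le_length_filter[where f = "\<lambda>r. ts ! 0 - r"]) auto
  finally show ?thesis .
qed

lemma last_zone_le:
  assumes "covering ts rs h" "ts \<noteq> []"
  shows "h - ts ! (length ts - 1) \<le> end_len (zone_count ts rs (length ts))"
proof -
  let ?t = "ts ! (length ts - 1)"
  let ?R = "(\<lambda>r. r - ?t) ` set rs"
  have t0: "0 \<le> ?t" "?t \<le> h" and rs: "set rs \<subseteq> {0..h}"
    using assms covering_nth[of ts rs h "length ts - 1"] by (auto simp: covering_def)
  have le_t: "t \<le> ?t" if "t \<in> set ts" for t
    using assms that by (auto simp: covering_def in_set_conv_nth intro!: sorted_nth_mono)
  have "h - ?t \<le> end_len (card (?R \<inter> {0<..h - ?t}))"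
  proof (rule segment_le_end_len)
    fix p assume p: "0 \<le> p" "p \<le> h - ?t"
    then have "?t + p \<in> {0..h}" using t0 by auto
    then obtain t r where tr: "t \<in> set ts" "r \<in> set rs" "\<bar>?t + p - t\<bar> * \<bar>?t + p - r\<bar> \<le> 1"
      using assms unfolding covering_def covered_def by blast
    have "p * \<bar>?t + p - r\<bar> \<le> \<bar>?t + p - t\<bar> * \<bar>?t + p - r\<bar>"
      using le_t[OF tr(1)] p by (intro mult_right_mono) auto
    with tr have "p * \<bar>p - (r - ?t)\<bar> \<le> 1" by (simp add: algebra_simps)
    then show "\<exists>r\<in>?R. p * \<bar>p - r\<bar> \<le> 1" using tr(2) by blast
  qed (use t0 rs in auto)
  also have "\<dots> \<le> end_len (zone_count ts rs (length ts))"
    unfolding zone_count_def using assms(2)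
    by (intro end_len_mono card_le_length_filter[where f = "\<lambda>r. r - ?t"]) auto
  finally show ?thesis .
qed

lemma mid_zone_le:
  assumes "covering ts rs h" "0 < i" "i < length ts"
  shows "ts ! i - ts ! (i - 1) \<le> zone_len (zone_count ts rs i)"
proof -
  let ?t = "ts ! (i - 1)" and ?u = "ts ! i"
  let ?R = "(\<lambda>r. r - ?t) ` set rs"
  have t0: "0 \<le> ?t" "?t \<le> ?u" "?u \<le> h"
    using assms covering_nth[of ts rs h] by (auto simp: covering_def intro!: sorted_nth_mono)
  have outside: "t \<le> ?t \<or> ?u \<le> t" if t: "t \<in> set ts" for t
  proof -
    obtain j where j: "j < length ts" "t = ts ! j" using t by (auto simp: in_set_conv_nth)
    show ?thesis using j assms by (cases "j < i") (auto simp: covering_def intro!: sorted_nth_mono)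
  qed
  have "?u - ?t \<le> zone_len (card (?R \<inter> {0<..<?u - ?t}))"
  proof (rule segment_le_zone_len)
    fix p assume p: "0 \<le> p" "p \<le> ?u - ?t"
    then have "?t + p \<in> {0..h}" using t0 by auto
    then obtain t r where tr: "t \<in> set ts" "r \<in> set rs" "\<bar>?t + p - t\<bar> * \<bar>?t + p - r\<bar> \<le> 1"
      using assms unfolding covering_def covered_def by blast
    have "min p (?u - ?t - p) * \<bar>?t + p - r\<bar> \<le> \<bar>?t + p - t\<bar> * \<bar>?t + p - r\<bar>"
      using outside[OF tr(1)] p by (intro mult_right_mono) auto
    with tr have "min p (?u - ?t - p) * \<bar>p - (r - ?t)\<bar> \<le> 1" by (simp add: algebra_simps)
    then show "\<exists>r\<in>?R. min p (?u - ?t - p) * \<bar>p - r\<bar> \<le> 1" using tr(2) by blast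
  qed (use t0 in auto)
  also have "\<dots> \<le> zone_len (zone_count ts rs i)"
    unfolding zone_count_def using assms
    by (intro zone_len_mono card_le_length_filter[where f = "\<lambda>r. r - ?t"]) auto
  finally show ?thesis .
qed

lemma covering_length_le:
  assumes "covering ts rs h" "length ts = M" "1 \<le> M"
  shows "h \<le> end_len (zone_count ts rs 0) + (\<Sum>i\<in>{1..<M}. zone_len (zone_count ts rs i))
              + end_len (zone_count ts rs M)"
proof -
  have ne: "ts \<noteq> []" using assms by auto
  have "(\<Sum>i\<in>{Suc 0..<M}. ts ! i - ts ! (i - 1)) = ts ! (M - 1) - ts ! 0"
    using sum_Suc_diff'[of 0 "M - 1" "(!) ts"] sum.shift_bounds_Suc_ivl[of "\<lambda>i. ts ! i - ts ! (i - 1)" 0 "M - 1"]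
      assms by simp
  moreover have "(\<Sum>i\<in>{Suc 0..<M}. ts ! i - ts ! (i - 1)) \<le> (\<Sum>i\<in>{1..<M}. zone_len (zone_count ts rs i))"
    unfolding One_nat_def[symmetric] using mid_zone_le[OF assms(1)] assms(2) by (intro sum_mono) auto
  ultimately show ?thesis
    using first_zone_le[OF assms(1) ne] last_zone_le[OF assms(1) ne] assms(2) by simp
qed

section \<open>Optimality of balanced counts\<close>

text \<open>The distance from the \<open>k\<close>-th receiver to the next one when the bounds
  \<open>2 * sqrt k\<close> are attained; these numbers are also the slopes of
  \<open>zone_len\<close>.\<close>

definition gap :: "nat \<Rightarrow> real" where
  "gap k = 2 * (sqrt (k + 1) - sqrt k)"

lemma gap_eq: "gap k = 2 / (sqrt (k + 1) + sqrt k)"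
proof -
  have "(sqrt (k + 1) - sqrt k) * (sqrt (k + 1) + sqrt k) = 1"
    by (simp add: algebra_simps)
  moreover have "sqrt (k + 1) + sqrt k > 0" by (simp add: add_pos_nonneg)
  ultimately show ?thesis by (simp add: gap_def field_simps)
qed

lemma gap_antimono: "k \<le> l \<Longrightarrow> gap l \<le> gap k"
  unfolding gap_eq by (intro divide_left_mono add_mono mult_pos_pos) (auto simp: add_pos_nonneg)

lemma gap_pos: "0 < gap k"
  by (simp add: gap_def)

lemma gap_le_2: "gap k \<le> 2"
  using gap_antimono[of 0 k] by (simp add: gap_def)

lemma zone_len_Suc: "zone_len (Suc n) - zone_len n = gap ((n + 1) div 2)"
  by (simp add: zone_len_def gap_def algebra_simps)

lemma end_len_Suc: "2 * end_len (Suc n) = 2 * end_len n + gap n + gap (Suc n)"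
  by (simp add: end_len_def gap_def field_simps)

text \<open>A supporting line for a discrete function: walk from \<open>m\<close> to
  \<open>n\<close> one step at a time and add up the bounds on the increments.\<close>

lemma le_tangent:
  fixes F :: "nat \<Rightarrow> real"
  assumes "\<And>k. m \<le> k \<Longrightarrow> F (Suc k) - F k \<le> c"
    and "\<And>k. k < m \<Longrightarrow> k \<ge> n \<Longrightarrow> c \<le> F (Suc k) - F k"
  shows "F n \<le> F m + c * (real n - real m)"
proof (cases "m \<le> n")
  case True
  then show ?thesis
  proof (induction rule: dec_induct)
    case (step k)
    then show ?case using assms(1)[of k] by (simp add: algebra_simps)
  qed simp
next
  case False
  then have "n \<le> m" by simp
  then show ?thesis using assms(2)
  proof (induction rule: inc_induct)
    case (step k)
    have "c \<le> F (Suc k) - F k" using step.prems[of k] step.hyps by simp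
    moreover have "F (Suc k) \<le> F m + c * (real (Suc k) - real m)"
      using step.IH step.prems by simp
    ultimately show ?case by (simp add: algebra_simps)
  qed simp
qed

lemma zone_len_tangent:
  assumes "gap ((m + 1) div 2) \<le> c" "c \<le> gap (m div 2)"
  shows "zone_len n \<le> zone_len m + c * (real n - real m)"
proof (rule le_tangent)
  fix k assume "m \<le> k"
  then have "gap ((k + 1) div 2) \<le> gap ((m + 1) div 2)" by (intro gap_antimono div_le_mono) simp
  then show "zone_len (Suc k) - zone_len k \<le> c" using assms zone_len_Suc[of k] by linarith
next
  fix k assume "k < m"
  then have "gap (m div 2) \<le> gap ((k + 1) div 2)" by (intro gap_antimono div_le_mono) simp
  then show "c \<le> zone_len (Suc k) - zone_len k" using assms zone_len_Suc[of k] by linarith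
qed

lemma end_len_tangent:
  assumes "gap m + gap (Suc m) \<le> 2 * c" "0 < m \<Longrightarrow> 2 * c \<le> gap (m - 1) + gap m"
  shows "end_len n \<le> end_len m + c * (real n - real m)"
proof (rule le_tangent)
  fix k assume "m \<le> k"
  then have "gap k \<le> gap m" "gap (Suc k) \<le> gap (Suc m)" by (intro gap_antimono; simp)+
  then show "end_len (Suc k) - end_len k \<le> c" using assms end_len_Suc[of k] by linarith
next
  fix k assume "k < m"
  then have "gap (m - 1) \<le> gap k" "gap m \<le> gap (Suc k)" by (intro gap_antimono; simp)+
  with \<open>k < m\<close> show "c \<le> end_len (Suc k) - end_len k" using assms end_len_Suc[of k] by linarith
qed

text \<open>The slope 2 is \<open>gap 0\<close>, the largest one. This cruder line and its analogue
  for \<open>end_len\<close> serve the case of equally many transmitters and receivers.\<close>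

lemma zone_len_growth: "m \<le> n \<Longrightarrow> zone_len n \<le> zone_len m + 2 * (real n - real m)"
  by (rule le_tangent) (use zone_len_Suc gap_le_2 in auto)

lemma end_len_growth: "m \<le> n \<Longrightarrow> end_len n \<le> end_len m + 2 * (real n - real m)"
proof (rule le_tangent)
  show "end_len (Suc k) - end_len k \<le> 2" for k
    using end_len_Suc[of k] gap_le_2[of k] gap_le_2[of "Suc k"] by linarith
qed auto

text \<open>For \<open>M = 1\<close> there is no inner zone through which the end zones could be
  compared, so the last clause compares them directly.\<close>

definition balanced :: "nat \<Rightarrow> (nat \<Rightarrow> nat) \<Rightarrow> bool" where
  "balanced M n \<longleftrightarrow>
    (\<forall>i \<in> {1..<M}. \<forall>j \<in> {1..<M}. i \<noteq> j \<longrightarrow> \<bar>int (n i) - int (n j)\<bar> \<le> 1) \<and>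
    (\<forall>i \<in> {1..<M}. \<bar>int (n i) - 2 * int (n 0)\<bar> \<le> 1) \<and>
    (\<forall>i \<in> {1..<M}. \<bar>int (n i) - 2 * int (n M)\<bar> \<le> 1) \<and>
    (M = 1 \<longrightarrow> \<bar>int (n 0) - int (n M)\<bar> \<le> 1)"

text \<open>An even inner count \<open>2 * q\<close> forces both ends to be \<open>q\<close>.
  Otherwise all inner counts are odd and within one of each other, hence equal.\<close>

lemma balanced_cases:
  assumes "balanced M n" "1 \<le> M"
  obtains (even) q where "n 0 = q" "n M = q" "\<And>i. i \<in> {1..<M} \<Longrightarrow> 2 * q \<le> n i + 1 \<and> n i \<le> 2 * q + 1"
  | (odd) q where "n 0 \<in> {q, q + 1}" "n M \<in> {q, q + 1}" "\<And>i. i \<in> {1..<M} \<Longrightarrow> n i = 2 * q + 1"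
proof (cases "M = 1")
  case True
  \<comment> \<open>Without inner zones, equal ends fit the case \<open>even\<close>; ends differing
    by one fit \<open>odd\<close>, with the smaller one as \<open>q\<close>.\<close>
  then have "n 0 = n M \<or> n 0 = n M + 1 \<or> n M = n 0 + 1" using assms by (auto simp: balanced_def)
  then show ?thesis using that True by auto
next
  case False
  then have M: "1 \<in> {1..<M}" using assms by auto
  have pair: "\<bar>int (n i) - int (n j)\<bar> \<le> 1" if "i \<in> {1..<M}" "j \<in> {1..<M}" for i j
    using assms(1) that by (cases "i = j") (auto simp: balanced_def)
  have ends: "\<bar>int (n i) - 2 * int (n 0)\<bar> \<le> 1" "\<bar>int (n i) - 2 * int (n M)\<bar> \<le> 1"
    if "i \<in> {1..<M}" for i
    using assms(1) that by (auto simp: balanced_def)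
  show ?thesis
  proof (cases "\<exists>i\<in>{1..<M}. even (n i)")
    case True
    then obtain i q where i: "i \<in> {1..<M}" "n i = 2 * q" by (auto elim: evenE)
    show ?thesis
    proof (rule even[of q])
      show "n 0 = q" "n M = q" using ends[OF i(1)] i(2) by linarith+
      show "2 * q \<le> n j + 1 \<and> n j \<le> 2 * q + 1" if "j \<in> {1..<M}" for j
        using pair[OF i(1) that] i(2) by linarith
    qed
  next
    case False
    then have "odd (n 1)" using M by blast
    then obtain q where q: "n 1 = 2 * q + 1" by (rule oddE)
    show ?thesis
    proof (rule odd[of q])
      show "n 0 \<in> {q, q + 1}" "n M \<in> {q, q + 1}" using ends[OF M] q by auto
      show "n j = 2 * q + 1" if "j \<in> {1..<M}" for j
      proof -
        have "odd (n j)" using False that by blast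
        then obtain q' where "n j = 2 * q' + 1" by (rule oddE)
        then show ?thesis using pair[OF M that] q by simp
      qed
    qed
  qed
qed

text \<open>One slope supports both concave functions at every count that occurs, which is what
  makes zones of different kinds comparable.\<close>

lemma balanced_tangent:
  assumes "balanced M n" "1 \<le> M"
  obtains c where "\<And>k. end_len k \<le> end_len (n 0) + c * (real k - real (n 0))"
    and "\<And>k. end_len k \<le> end_len (n M) + c * (real k - real (n M))"
    and "\<And>i k. i \<in> {1..<M} \<Longrightarrow> zone_len k \<le> zone_len (n i) + c * (real k - real (n i))"
  using assms
proof (cases rule: balanced_cases)
  case (even q)
  \<comment> \<open>The value \<open>gap q\<close> lies between the slopes before and after
    \<open>q\<close> for \<open>end_len\<close>, and between those at \<open>2 * q - 1\<close>,
    \<open>2 * q\<close> and \<open>2 * q + 1\<close> for \<open>zone_len\<close>.\<close>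
  have e: "end_len k \<le> end_len q + gap q * (real k - real q)" for k
    by (rule end_len_tangent) (use gap_antimono[of q "Suc q"] gap_antimono[of "q - 1" q] in auto)
  have z: "zone_len k \<le> zone_len m + gap q * (real k - real m)"
    if "2 * q \<le> m + 1" "m \<le> 2 * q + 1" for k m
    by (rule zone_len_tangent) (use that in \<open>auto intro!: gap_antimono\<close>)
  show ?thesis
    by (rule that[of "gap q"]) (use e z even in auto)
next
  case (odd q)
  \<comment> \<open>This is the increment of \<open>end_len\<close> from \<open>q\<close> to
    \<open>q + 1\<close>, so one line touches \<open>end_len\<close> at both admissible counts; it
    also lies between the two slopes of \<open>zone_len\<close> at \<open>2 * q + 1\<close>.\<close>
  let ?c = "(gap q + gap (Suc q)) / 2"
  have g: "gap (Suc q) \<le> gap q" "gap (Suc (Suc q)) \<le> gap (Suc q)" "gap q \<le> gap (q - 1)"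
    by (auto intro!: gap_antimono)
  have e: "end_len k \<le> end_len m + ?c * (real k - real m)" if "m \<in> {q, q + 1}" for k m
    by (rule end_len_tangent) (use that g in auto)
  have z: "zone_len k \<le> zone_len (2 * q + 1) + ?c * (real k - real (2 * q + 1))" for k
    by (rule zone_len_tangent) (use g in auto)
  show ?thesis
    by (rule that[of ?c]) (use e z odd in auto)
qed

definition total_len :: "nat \<Rightarrow> (nat \<Rightarrow> nat) \<Rightarrow> real" where
  "total_len M n = end_len (n 0) + (\<Sum>i\<in>{1..<M}. zone_len (n i)) + end_len (n M)"

lemma sum_atMost_split_ends:
  fixes f :: "nat \<Rightarrow> 'a::comm_monoid_add"
  assumes "1 \<le> M"
  shows "(\<Sum>i\<le>M. f i) = f 0 + (\<Sum>i\<in>{1..<M}. f i) + f M"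
proof -
  obtain m where "M = Suc m" using assms by (cases M) auto
  moreover have "(\<Sum>i\<le>m. f i) = f 0 + (\<Sum>i\<in>{1..m}. f i)"
    by (simp add: sum.atLeast_Suc_atMost atMost_atLeast0)
  ultimately show ?thesis by (simp add: atLeastLessThanSuc_atLeastAtMost)
qed

text \<open>Adding the tangent inequalities of all zones, the terms with the common slope cancel
  because the totals agree.\<close>

lemma total_len_le_balanced:
  assumes "balanced M n" "1 \<le> M" "(\<Sum>i\<le>M. m i) = (\<Sum>i\<le>M. n i)"
  shows "total_len M m \<le> total_len M n"
proof -
  obtain c where c: "\<And>k. end_len k \<le> end_len (n 0) + c * (real k - real (n 0))"
    "\<And>k. end_len k \<le> end_len (n M) + c * (real k - real (n M))"
    "\<And>i k. i \<in> {1..<M} \<Longrightarrow> zone_len k \<le> zone_len (n i) + c * (real k - real (n i))"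
    using balanced_tangent[OF assms(1,2)] by blast
  have "(\<Sum>i\<in>{1..<M}. zone_len (m i)) \<le>
      (\<Sum>i\<in>{1..<M}. zone_len (n i) + c * (real (m i) - real (n i)))"
    by (intro sum_mono c)
  also have "\<dots> = (\<Sum>i\<in>{1..<M}. zone_len (n i)) + c * (real (\<Sum>i\<in>{1..<M}. m i) - real (\<Sum>i\<in>{1..<M}. n i))"
    by (simp add: sum.distrib sum_subtractf sum_distrib_left algebra_simps)
  finally have mid: "(\<Sum>i\<in>{1..<M}. zone_len (m i)) \<le>
     (\<Sum>i\<in>{1..<M}. zone_len (n i)) + c * (real (\<Sum>i\<in>{1..<M}. m i) - real (\<Sum>i\<in>{1..<M}. n i))" .
  have "real (m 0) + real (\<Sum>i\<in>{1..<M}. m i) + real (m M) =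
      real (n 0) + real (\<Sum>i\<in>{1..<M}. n i) + real (n M)"
    using assms(3) unfolding sum_atMost_split_ends[OF assms(2)] by (metis of_nat_add)
  then have "real (\<Sum>i\<in>{1..<M}. m i) - real (\<Sum>i\<in>{1..<M}. n i) =
      real (n 0) - real (m 0) + (real (n M) - real (m M))" by linarith
  then have "c * (real (\<Sum>i\<in>{1..<M}. m i) - real (\<Sum>i\<in>{1..<M}. n i)) =
      c * (real (n 0) - real (m 0)) + c * (real (n M) - real (m M))" by (simp add: distrib_left)
  moreover have "c * (real (m 0) - real (n 0)) = - (c * (real (n 0) - real (m 0)))"
    "c * (real (m M) - real (n M)) = - (c * (real (n M) - real (m M)))"
    by (simp_all add: algebra_simps)
  ultimately show ?thesis
    using mid c(1)[of "m 0"] c(2)[of "m M"] unfolding total_len_def by linarith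
qed

lemma covering_le_balanced:
  assumes "balanced M n" "1 \<le> M" "(\<Sum>i\<le>M. n i) = N"
    and "covering ts rs h" "length ts = M" "length rs = N"
  shows "h \<le> total_len M n"
proof -
  have "h \<le> total_len M (zone_count ts rs)"
    using covering_length_le[OF assms(4,5,2)] by (simp add: total_len_def)
  also have "\<dots> \<le> total_len M n"
  proof (rule total_len_le_balanced[OF assms(1,2)])
    show "sum (zone_count ts rs) {..M} = sum n {..M}"
      using sum_zone_count[of ts rs] assms unfolding covering_def by fastforce
  qed
  finally show ?thesis .
qed

text \<open>The midpoint of a stretch free of nodes is at least half its length away from every
  transmitter and every receiver.\<close>

lemma covering_gap_le:
  assumes "covering ts rs h" "0 \<le> a" "a \<le> b" "b \<le> h"
    and out: "\<And>x. x \<in> set ts \<union> set rs \<Longrightarrow> x \<le> a \<or> b \<le> x"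
  shows "b - a \<le> 2"
proof -
  define p where "p = (a + b) / 2"
  have "p \<in> {0..h}" using assms by (auto simp: p_def)
  then obtain t r where tr: "t \<in> set ts" "r \<in> set rs" "\<bar>p - t\<bar> * \<bar>p - r\<bar> \<le> 1"
    using assms(1) unfolding covering_def covered_def by blast
  have far: "(b - a) / 2 \<le> \<bar>p - x\<bar>" if "x \<in> set ts \<union> set rs" for x
  proof -
    have "(b - a) / 2 \<le> p - x \<or> (b - a) / 2 \<le> x - p"
      using out[OF that] by (auto simp: p_def field_simps)
    then show ?thesis by linarith
  qed
  have "((b - a) / 2) * ((b - a) / 2) \<le> \<bar>p - t\<bar> * \<bar>p - r\<bar>"
    using far tr assms(3) by (intro mult_mono) auto
  then have "((b - a) / 2)\<^sup>2 \<le> 1\<^sup>2" using tr by (simp add: power2_eq_square)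
  then have "(b - a) / 2 \<le> 1" by (rule power2_le_imp_le) simp
  then show ?thesis by simp
qed

text \<open>Used to turn the number of receivers below a transmitter into comparisons between the
  two sorted sequences.\<close>

lemma sorted_count_less:
  fixes xs :: "real list"
  assumes "sorted xs" "length (filter (\<lambda>y. y < x) xs) = m" "j < length xs"
  shows "xs ! j < x \<longleftrightarrow> j < m"
proof -
  let ?A = "{i. i < length xs \<and> xs ! i < x}"
  have m: "card ?A = m" using assms(2) by (simp add: length_filter_conv_card)
  show ?thesis
  proof
    assume "xs ! j < x"
    then have "{..j} \<subseteq> ?A" using assms by (auto intro: le_less_trans sorted_nth_mono)
    from card_mono[OF _ this] show "j < m" using m by simp
  next
    assume "j < m"
    show "xs ! j < x"
    proof (rule ccontr)
      assume "\<not> xs ! j < x"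
      then have "i < j" if "i < length xs" "xs ! i < x" for i
        using sorted_nth_mono[OF assms(1), of j i] that by (rule_tac ccontr) simp
      then have "?A \<subseteq> {..<j}" by auto
      from card_mono[OF _ this] show False using m \<open>j < m\<close> by simp
    qed
  qed
qed

section \<open>Equally many transmitters and receivers\<close>

text \<open>Here \<open>a\<close> and \<open>b\<close> stand for the distances from an end of the
  segment to its two nearest nodes; the extreme case is \<open>a = sqrt 2 - 1\<close>,
  \<open>b = sqrt 2 + 1\<close>.\<close>

lemma sqrt_product_bound:
  fixes a b :: real
  assumes "0 \<le> a" "a * b \<le> 1" "b - a \<le> 2"
  shows "b \<le> 1 + sqrt 2"
proof (cases "b \<le> 1")
  case True
  then show ?thesis by (smt (verit) real_sqrt_ge_zero)
next
  case False
  then have "(b - 2) * b \<le> a * b" using assms by (intro mult_right_mono) auto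
  with assms have "(b - 1)\<^sup>2 \<le> 2" by (simp add: power2_eq_square algebra_simps)
  then have "b - 1 \<le> sqrt 2" by (rule real_le_rsqrt)
  then show ?thesis by simp
qed

text \<open>The bound is the length of the alternating placement: \<open>2 * M - 1\<close> spacings
  of length 2 and two ends of length \<open>sqrt 2 - 1\<close>. With a receiver in both end zones,
  lines of slope 2, starting at count 1 for the ends and 0 for inner zones, add up to exactly
  this.\<close>

lemma covering_equal_le_of_ends:
  assumes cov: "covering ts rs h" and len: "length ts = M" "length rs = M" and M: "1 \<le> M"
    and ends: "rs ! 0 < ts ! 0" "ts ! (M - 1) \<le> rs ! (M - 1)"
  shows "h \<le> 4 * real M - 4 + 2 * sqrt 2"
proof -
  define z where "z = zone_count ts rs"
  \<comment> \<open>Zones are closed on the left only: a strict inequality is needed for the first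
    zone, a weak one suffices for the last.\<close>
  have "rs ! 0 \<in> set (filter (\<lambda>r. r < ts ! 0) rs)" using ends len M by auto
  then have z0: "1 \<le> z 0" using M len
    by (auto simp: z_def zone_count_def Suc_le_eq length_greater_0_conv simp del: length_greater_0_conv set_filter
        intro: length_pos_if_in_set)
  have "rs ! (M - 1) \<in> set (filter (\<lambda>r. ts ! (M - 1) \<le> r) rs)" using ends len M by auto
  then have zM: "1 \<le> z M" using M len
    by (auto simp: z_def zone_count_def Suc_le_eq simp del: set_filter intro: length_pos_if_in_set)
  have "ts \<noteq> []" "sorted ts" using cov len M by (auto simp: covering_def)
  then have "(\<Sum>i\<le>M. z i) = M" using sum_zone_count[of ts rs] len by (simp add: z_def)
  then have "z 0 + (\<Sum>i\<in>{1..<M}. z i) + z M = M" using sum_atMost_split_ends[OF M, of z] by simp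
  then have sum: "real (z 0) + (\<Sum>i\<in>{1..<M}. real (z i)) + real (z M) = real M"
    by (metis of_nat_add of_nat_sum)
  have "(\<Sum>i\<in>{1..<M}. zone_len (z i)) \<le> (\<Sum>i\<in>{1..<M}. 2 + 2 * real (z i))"
    using zone_len_growth[of 0] by (intro sum_mono) (simp add: zone_len_def)
  also have "\<dots> = 2 * (real M - 1) + 2 * (\<Sum>i\<in>{1..<M}. real (z i))"
    using M by (simp add: sum.distrib sum_distrib_left of_nat_diff)
  finally have "(\<Sum>i\<in>{1..<M}. zone_len (z i)) \<le> 2 * (real M - 1) + 2 * (\<Sum>i\<in>{1..<M}. real (z i))" .
  moreover have "h \<le> end_len (z 0) + (\<Sum>i\<in>{1..<M}. zone_len (z i)) + end_len (z M)"
    using covering_length_le[OF cov len(1) M] by (simp add: z_def)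
  moreover have "end_len 1 = 1 + sqrt 2" by (simp add: end_len_def)
  ultimately show ?thesis
    using end_len_growth[OF z0] end_len_growth[OF zM] sum by simp
qed

text \<open>When the types alternate, the stretch between neighbours is free of nodes and thus at
  most 2 long; the two outer stretches are controlled by coverage of 0 and \<open>h\<close>.\<close>

lemma covering_equal_le_of_interleaved:
  assumes cov: "covering ts rs h" and len: "length ts = M" "length rs = M" and M: "1 \<le> M"
    and tr: "\<And>i. i < M \<Longrightarrow> ts ! i \<le> rs ! i"
    and rt: "\<And>i. i + 1 < M \<Longrightarrow> rs ! i \<le> ts ! (i + 1)"
  shows "h \<le> 4 * real M - 4 + 2 * sqrt 2"
proof -
  have st: "sorted ts" and sr: "sorted rs" using cov by (auto simp: covering_def)
  have bounds: "0 \<le> ts ! i" "ts ! i \<le> h" "0 \<le> rs ! i" "rs ! i \<le> h" if "i < M" for i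
    using covering_nth[OF cov] covering_nth[OF covering_commute[OF cov]] that len by auto
  have out_t: "x \<le> ts ! i \<or> rs ! i \<le> x" if i: "i < M" and x: "x \<in> set ts \<union> set rs" for x i
    using x
  proof
    assume "x \<in> set ts"
    then obtain j where j: "j < M" "x = ts ! j" using len by (auto simp: in_set_conv_nth)
    show ?thesis
    proof (cases "j \<le> i")
      case True
      then show ?thesis using j i len st by (auto intro: sorted_nth_mono)
    next
      case False
      then have "rs ! i \<le> ts ! (i + 1)" "ts ! (i + 1) \<le> ts ! j"
        using rt[of i] j len st by (auto intro!: sorted_nth_mono)
      then show ?thesis using j by simp
    qed
  next
    assume "x \<in> set rs"
    then obtain j where j: "j < M" "x = rs ! j" using len by (auto simp: in_set_conv_nth)
    show ?thesis
    proof (cases "i \<le> j")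
      case True
      then show ?thesis using j i len sr by (auto intro: sorted_nth_mono)
    next
      case False
      then have "rs ! j \<le> ts ! (j + 1)" "ts ! (j + 1) \<le> ts ! i"
        using rt[of j] i len st by (auto intro!: sorted_nth_mono)
      then show ?thesis using j by simp
    qed
  qed
  have out_r: "x \<le> rs ! i \<or> ts ! (i + 1) \<le> x" if i: "i + 1 < M" and x: "x \<in> set ts \<union> set rs" for x i
    using x
  proof
    assume "x \<in> set ts"
    then obtain j where j: "j < M" "x = ts ! j" using len by (auto simp: in_set_conv_nth)
    show ?thesis
    proof (cases "j \<le> i")
      case True
      then have "ts ! j \<le> ts ! i" using j i len st by (auto intro: sorted_nth_mono)
      then show ?thesis using j tr[of i] i by simp
    next
      case False
      then show ?thesis using j len st by (auto intro!: sorted_nth_mono)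
    qed
  next
    assume "x \<in> set rs"
    then obtain j where j: "j < M" "x = rs ! j" using len by (auto simp: in_set_conv_nth)
    show ?thesis
    proof (cases "j \<le> i")
      case True
      then show ?thesis using j i len sr by (auto intro: sorted_nth_mono)
    next
      case False
      then have "ts ! (i + 1) \<le> ts ! j" using j len st by (auto intro!: sorted_nth_mono)
      then show ?thesis using j tr[of j] by simp
    qed
  qed
  have gap_t: "rs ! i - ts ! i \<le> 2" if "i < M" for i
    using covering_gap_le[OF cov, of "ts ! i" "rs ! i"] out_t[OF that] bounds[OF that] tr[OF that] by blast
  have gap_r: "ts ! (i + 1) - rs ! i \<le> 2" if "i + 1 < M" for i
    using covering_gap_le[OF cov, of "rs ! i" "ts ! (i + 1)"] out_r[OF that] bounds[of i]
      bounds[OF that] rt[OF that] that by simp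
  have chain: "ts ! (i + 1) - rs ! 0 \<le> 4 * real i + 2" if "i + 1 < M" for i
    using that
  proof (induction i)
    case 0
    then show ?case using gap_r[of 0] by simp
  next
    case (Suc i)
    then show ?case using gap_r[of "Suc i"] gap_t[of "Suc i"] by simp
  qed
  \<comment> \<open>Some pair covers the point 0, and no pair has a smaller product there than the
    two first nodes.\<close>
  have left: "ts ! 0 * rs ! 0 \<le> 1"
  proof -
    have "0 \<in> {0..h}" using bounds[of 0] M by auto
    then obtain t r where "t \<in> set ts" "r \<in> set rs" "\<bar>0 - t\<bar> * \<bar>0 - r\<bar> \<le> 1"
      using cov unfolding covering_def covered_def by blast
    moreover from this have "ts ! 0 \<le> t" "rs ! 0 \<le> r"
      using st sr M len by (auto simp: in_set_conv_nth intro!: sorted_nth_mono)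
    then have "ts ! 0 * rs ! 0 \<le> \<bar>0 - t\<bar> * \<bar>0 - r\<bar>" using bounds[of 0] M by (intro mult_mono) auto
    ultimately show ?thesis by linarith
  qed
  have right: "(h - rs ! (M - 1)) * (h - ts ! (M - 1)) \<le> 1"
  proof -
    have "h \<in> {0..h}" using bounds[of 0] M by auto
    then obtain t r where "t \<in> set ts" "r \<in> set rs" "\<bar>h - t\<bar> * \<bar>h - r\<bar> \<le> 1"
      using cov unfolding covering_def covered_def by blast
    moreover from this have "t \<le> ts ! (M - 1)" "r \<le> rs ! (M - 1)"
      using st sr M len by (auto simp: in_set_conv_nth intro!: sorted_nth_mono)
    then have "(h - ts ! (M - 1)) * (h - rs ! (M - 1)) \<le> \<bar>h - t\<bar> * \<bar>h - r\<bar>"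
      using bounds[of "M - 1"] M by (intro mult_mono) auto
    ultimately show ?thesis by (simp add: mult.commute)
  qed
  show ?thesis
  proof (cases "M = 1")
    case True
    \<comment> \<open>The end estimates used for larger \<open>M\<close> would overlap in a single
      pair. Measuring to its midpoint instead writes each product as a difference of
      squares.\<close>
    define m a where "m = (ts ! 0 + rs ! 0) / 2" and "a = (rs ! 0 - ts ! 0) / 2"
    have a: "0 \<le> a" "a \<le> 1" using tr[of 0] gap_t[of 0] True by (auto simp: a_def)
    then have "a\<^sup>2 \<le> 1" by (simp add: power_le_one)
    have "m\<^sup>2 = ts ! 0 * rs ! 0 + a\<^sup>2" "(h - m)\<^sup>2 = (h - rs ! 0) * (h - ts ! 0) + a\<^sup>2"
      by (simp_all add: m_def a_def power2_eq_square field_simps)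
    with left right True \<open>a\<^sup>2 \<le> 1\<close> have "m\<^sup>2 \<le> 2" "(h - m)\<^sup>2 \<le> 2" by auto
    then have "m \<le> sqrt 2" "h - m \<le> sqrt 2" by (auto intro: real_le_rsqrt)
    then show ?thesis using True by simp
  next
    case False
    with M have M2: "M - 2 + 1 = M - 1" "M - 1 < M" by auto
    have "rs ! 0 \<le> 1 + sqrt 2"
      by (rule sqrt_product_bound[OF _ left]) (use bounds[of 0] gap_t[of 0] M in auto)
    moreover have "h - ts ! (M - 1) \<le> 1 + sqrt 2"
      by (rule sqrt_product_bound[OF _ right]) (use bounds[of "M - 1"] gap_t[of "M - 1"] M in auto)
    moreover have "ts ! (M - 1) - rs ! 0 \<le> 4 * real (M - 2) + 2"
      using chain[of "M - 2"] M2 by simp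
    moreover have "real (M - 2) = real M - 2" using False M by simp
    ultimately show ?thesis by simp
  qed
qed

text \<open>Since zone 0 is empty, the lines of slope 2 overshoot the bound by
  \<open>2 - sqrt 2\<close>. A last or inner zone with two receivers loses at least that much by
  concavity; without such a zone all zones but the first hold exactly one receiver and the nodes
  alternate.\<close>

lemma covering_equal_le_of_first:
  assumes cov: "covering ts rs h" and len: "length ts = M" "length rs = M" and M: "1 \<le> M"
    and ends: "ts ! 0 \<le> rs ! 0" "ts ! (M - 1) \<le> rs ! (M - 1)"
  shows "h \<le> 4 * real M - 4 + 2 * sqrt 2"
proof -
  define z where "z = zone_count ts rs"
  have ts: "ts \<noteq> []" "sorted ts" and sr: "sorted rs" using cov len M by (auto simp: covering_def)
  have "filter (\<lambda>r. r < ts ! 0) rs = []"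
  proof -
    have "ts ! 0 \<le> r" if "r \<in> set rs" for r
    proof -
      have "rs ! 0 \<le> r" using that sr by (auto simp: in_set_conv_nth intro!: sorted_nth_mono)
      then show ?thesis using ends by simp
    qed
    then show ?thesis by (auto simp: filter_empty_conv not_less)
  qed
  then have z0: "z 0 = 0" using ts by (auto simp: z_def zone_count_def filter_empty_conv)
  have "rs ! (M - 1) \<in> set (filter (\<lambda>r. ts ! (M - 1) \<le> r) rs)" using ends len M by auto
  then have zM: "1 \<le> z M" using M len
    by (auto simp: z_def zone_count_def Suc_le_eq simp del: set_filter intro: length_pos_if_in_set)
  have "(\<Sum>i\<le>M. z i) = M" using sum_zone_count[of ts rs] len ts by (simp add: z_def)
  then have sum: "(\<Sum>i\<in>{1..<M}. z i) + z M = M" using sum_atMost_split_ends[OF M, of z] z0 by simp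
  then have rsum: "(\<Sum>i\<in>{1..<M}. real (z i)) + real (z M) = real M"
    by (metis of_nat_add of_nat_sum)
  have total: "h \<le> 1 + (\<Sum>i\<in>{1..<M}. zone_len (z i)) + end_len (z M)"
    using covering_length_le[OF cov len(1) M] z0 by (simp add: z_def end_len_def)
  have lin: "(\<Sum>i\<in>A. zone_len (z i)) \<le> (\<Sum>i\<in>A. 2 + 2 * real (z i))" for A :: "nat set"
    using zone_len_growth[of 0] by (intro sum_mono) (simp add: zone_len_def)
  have lin_eq: "(\<Sum>i\<in>{1..<M}. 2 + 2 * real (z i)) = 2 * (real M - 1) + 2 * (\<Sum>i\<in>{1..<M}. real (z i))"
    using M by (simp add: sum.distrib sum_distrib_left of_nat_diff)
  have s2: "sqrt 2 \<le> 2" using real_le_lsqrt[of 2 2] by simp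
  have s3: "sqrt 3 \<le> 1 + sqrt 2"
    using real_le_lsqrt[of "1 + sqrt 2" 3] by (simp add: power2_eq_square algebra_simps)
  have end1: "end_len 1 = 1 + sqrt 2" and end2: "end_len 2 = sqrt 2 + sqrt 3"
    and zone2: "zone_len 2 = 2 + 2 * sqrt 2"
    by (auto simp: end_len_def zone_len_def)
  consider (last) "2 \<le> z M" | (mid) j where "j \<in> {1..<M}" "2 \<le> z j"
    | (one) "z M = 1" "\<And>i. i \<in> {1..<M} \<Longrightarrow> z i \<le> 1"
    using zM by force
  then show ?thesis
  proof cases
    case last
    show ?thesis
      using total lin[of "{1..<M}"] lin_eq end_len_growth[OF last] end2 s3 rsum by simp
  next
    case mid
    let ?A = "{1..<M} - {j}"
    have split: "(\<Sum>i\<in>{1..<M}. f i) = f j + (\<Sum>i\<in>?A. f i)" for f :: "nat \<Rightarrow> real"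
      using mid by (intro sum.remove) auto
    have "zone_len (z j) \<le> 2 + 2 * real (z j) - (4 - 2 * sqrt 2)"
      using zone_len_growth[OF mid(2)] zone2 by simp
    then have "(\<Sum>i\<in>{1..<M}. zone_len (z i)) \<le> (\<Sum>i\<in>{1..<M}. 2 + 2 * real (z i)) - (4 - 2 * sqrt 2)"
      using lin[of ?A] split[of "\<lambda>i. zone_len (z i)"] split[of "\<lambda>i. 2 + 2 * real (z i)"] by linarith
    then show ?thesis
      using total lin_eq end_len_growth[OF zM] end1 s2 rsum by simp
  next
    case one
    have "z i = 1" if i: "i \<in> {1..<M}" for i
    proof (rule ccontr)
      assume "z i \<noteq> 1"
      then have "z i < 1" using one(2)[OF i] by simp
      then have "(\<Sum>i\<in>{1..<M}. z i) < (\<Sum>i\<in>{1..<M}. 1)"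
        using one(2) i by (intro sum_strict_mono_ex1) auto
      then show False using sum one(1) by simp
    qed
    \<comment> \<open>Zone 0 is empty and each later zone holds one receiver, so exactly
      \<open>m\<close> receivers lie below the transmitter with zero-based index
      \<open>m\<close>.\<close>
    then have cum: "length (filter (\<lambda>r. r < ts ! m) rs) = m" if "m < M" for m
    proof -
      have "(\<Sum>i\<le>m. z i) = (\<Sum>i\<le>m. if i = 0 then 0 else 1)"
        using \<open>\<And>i. i \<in> {1..<M} \<Longrightarrow> z i = 1\<close> z0 that by (intro sum.cong) auto
      also have "\<dots> = m" by (induction m) auto
      finally show ?thesis
        using sum_zone_count_less[OF ts(2), of m rs] that len by (simp add: z_def)
    qed
    show ?thesis
    proof (rule covering_equal_le_of_interleaved[OF cov len M])
      show "ts ! i \<le> rs ! i" if "i < M" for i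
        using sorted_count_less[OF sr cum[OF that], of i] that len by (simp add: not_less)
      show "rs ! i \<le> ts ! (i + 1)" if "i + 1 < M" for i
        using sorted_count_less[OF sr cum[OF that], of i] that len by simp
    qed
  qed
qed

text \<open>Coverage is symmetric in the two types. Up to exchanging them, either receivers are
  outermost on both sides or a transmitter comes first and a receiver last.\<close>

lemma covering_equal_le:
  assumes cov: "covering ts rs h" and len: "length ts = M" "length rs = M" and M: "1 \<le> M"
  shows "h \<le> 4 * real M - 4 + 2 * sqrt 2"
proof -
  note cov' = covering_commute[OF cov]
  consider "rs ! 0 < ts ! 0" "ts ! (M - 1) \<le> rs ! (M - 1)"
    | "ts ! 0 < rs ! 0" "rs ! (M - 1) \<le> ts ! (M - 1)"
    | "ts ! 0 \<le> rs ! 0" "ts ! (M - 1) \<le> rs ! (M - 1)"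
    | "rs ! 0 \<le> ts ! 0" "rs ! (M - 1) \<le> ts ! (M - 1)"
    by linarith
  then show ?thesis
  proof cases
    case 1 then show ?thesis by (rule covering_equal_le_of_ends[OF cov len M])
  next
    case 2 then show ?thesis by (rule covering_equal_le_of_ends[OF cov' len(2,1) M])
  next
    case 3 then show ?thesis by (rule covering_equal_le_of_first[OF cov len M])
  next
    case 4 then show ?thesis by (rule covering_equal_le_of_first[OF cov' len(2,1) M])
  qed
qed

section \<open>From spacings to coverings\<close>

lemma pos_mono:
  assumes "\<forall>d\<in>set D. 0 \<le> d" "k \<le> l"
  shows "pos D k \<le> pos D l"
proof -
  have "take l D = take k D @ take (l - k) (drop k D)"
    using assms(2) take_add[of k "l - k" D] by simp
  moreover have "0 \<le> sum_list (take (l - k) (drop k D))"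
    using assms(1) by (intro sum_list_nonneg) (meson in_set_dropD in_set_takeD)
  ultimately show ?thesis by (simp add: pos_def)
qed

lemma pos_bounds:
  assumes "\<forall>d\<in>set D. 0 \<le> d"
  shows "0 \<le> pos D k" "pos D k \<le> sum_list D"
proof -
  show "0 \<le> pos D k" using pos_mono[OF assms, of 0 k] by (simp add: pos_def)
  show "pos D k \<le> sum_list D" using pos_mono[OF assms, of k "k + length D"] by (simp add: pos_def)
qed

definition products :: "node list \<Rightarrow> real list \<Rightarrow> real \<Rightarrow> real set" where
  "products S D p = {\<bar>pos D i - p\<bar> * \<bar>pos D j - p\<bar> | i j.
     i < length S \<and> j < length S \<and> type_of (S ! i) = TX \<and> type_of (S ! j) = RX}"

lemma I_eq_Min_products: "I S D p = Min (products S D p)"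
  by (simp add: I_def products_def)

lemma finite_products: "finite (products S D p)"
proof -
  have "products S D p \<subseteq> (\<lambda>(i, j). \<bar>pos D i - p\<bar> * \<bar>pos D j - p\<bar>) ` ({..<length S} \<times> {..<length S})"
    by (auto simp: products_def)
  then show ?thesis by (rule finite_subset) simp
qed

definition indices :: "node_type \<Rightarrow> node list \<Rightarrow> nat list" where
  "indices a S = filter (\<lambda>k. type_of (S ! k) = a) [0..<length S]"

lemma set_indices: "set (indices a S) = {k. k < length S \<and> type_of (S ! k) = a}"
  by (auto simp: indices_def)

lemma length_indices: "length (indices a S) = length (filter (\<lambda>x. type_of x = a) S)"
proof -
  have "filter (\<lambda>x. type_of x = a) (map ((!) S) [0..<length S]) = map ((!) S) (indices a S)"
    by (simp add: indices_def filter_map comp_def)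
  then show ?thesis by (metis length_map map_nth)
qed

lemma deployment_order_length:
  assumes "deployment_order M N S"
  shows "length S = M + N + 2" "length (indices TX S) = M" "length (indices RX S) = N"
proof -
  obtain ss where S: "S = Hl # ss @ [Hr]" "distinct ss"
    and ss: "set ss = Transmitter ` {1..M} \<union> Receiver ` {1..N}"
    using assms by (auto simp: deployment_order_def)
  have "length ss = card (Transmitter ` {1..M} \<union> Receiver ` {1..N})"
    using S(2) ss by (metis distinct_card)
  also have "\<dots> = M + N"
    by (subst card_Un_disjoint) (auto simp: card_image inj_on_def)
  finally show "length S = M + N + 2" using S by simp
  have eq: "length (filter P ss) = card {x \<in> set ss. P x}" for P
    using S(2) distinct_card[of "filter P ss"] by simp
  have "{x \<in> set ss. type_of x = TX} = Transmitter ` {1..M}" using ss by auto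
  then show "length (indices TX S) = M"
    using S eq by (simp add: length_indices card_image inj_on_def)
  have "{x \<in> set ss. type_of x = RX} = Receiver ` {1..N}" using ss by auto
  then show "length (indices RX S) = N"
    using S eq by (simp add: length_indices card_image inj_on_def)
qed

lemma deployment_order_nth:
  assumes "deployment_order M N S" "k < length S"
  shows "type_of (S ! k) \<in> {TX, RX} \<longleftrightarrow> 0 < k \<and> k \<le> M + N"
proof -
  obtain ss where S: "S = Hl # ss @ [Hr]"
    and ss: "set ss = Transmitter ` {1..M} \<union> Receiver ` {1..N}"
    using assms by (auto simp: deployment_order_def)
  have len: "length ss = M + N" using deployment_order_length(1)[OF assms(1)] S by simp
  consider "k = 0" | "0 < k" "k \<le> M + N" | "k = M + N + 1"
    using assms(2) S len by force
  then show ?thesis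
  proof cases
    case 2
    then have "S ! k \<in> set ss" using S len 2 by (auto simp: nth_Cons' nth_append)
    then show ?thesis using 2 ss by auto
  qed (use S len in \<open>auto simp: nth_append\<close>)
qed

text \<open>Dividing positions by \<open>s\<close> divides the products by the square of
  \<open>s\<close>, so the threshold becomes 1.\<close>

lemma covering_of_Q_le:
  assumes dep: "deployment_order M N S" and sp: "spacings S h D" and MN: "1 \<le> M" "1 \<le> N"
    and Q: "Q S D \<le> s\<^sup>2" and s: "0 < s"
  shows "covering (map (\<lambda>k. pos D k / s) (indices TX S)) (map (\<lambda>k. pos D k / s) (indices RX S)) (h / s)"
proof -
  have D: "\<forall>d\<in>set D. 0 \<le> d" and h: "sum_list D = h" using sp by (auto simp: spacings_def)
  note bounds = pos_bounds[OF D, unfolded h]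
  have sorted: "sorted (map (\<lambda>k. pos D k / s) (indices a S))" for a
  proof -
    have "sorted_wrt (\<le>) (indices a S)" by (simp add: indices_def sorted_wrt_filter)
    then have "sorted_wrt (\<lambda>x y. pos D x / s \<le> pos D y / s) (indices a S)"
      by (rule sorted_wrt_mono_rel[rotated]) (use pos_mono[OF D] s in \<open>auto simp: divide_right_mono\<close>)
    then show ?thesis by (simp add: sorted_map)
  qed
  have nonempty: "products S D p \<noteq> {}" for p
  proof -
    have "set (indices TX S) \<noteq> {}" "set (indices RX S) \<noteq> {}"
      using deployment_order_length[OF dep] MN by auto
    then show ?thesis unfolding set_indices products_def by blast
  qed
  \<comment> \<open>Only for a bounded function does the supremum \<open>Q\<close> control single
    values; here all distances are at most \<open>h\<close>.\<close>
  have bdd: "bdd_above (I S D ` {0..h})"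
  proof (rule bdd_aboveI2)
    fix p assume p: "p \<in> {0..h}"
    obtain x where x: "x \<in> products S D p" using nonempty by blast
    then obtain i j where "x = \<bar>pos D i - p\<bar> * \<bar>pos D j - p\<bar>" by (auto simp: products_def)
    also have "\<dots> \<le> h * h" using bounds[of i] bounds[of j] p by (intro mult_mono) auto
    finally show "I S D p \<le> h * h"
      using Min_le[OF finite_products x] by (simp add: I_eq_Min_products)
  qed
  have "covered (map (\<lambda>k. pos D k / s) (indices TX S)) (map (\<lambda>k. pos D k / s) (indices RX S)) (h / s)"
    unfolding covered_def
  proof
    fix p assume p: "p \<in> {0..h / s}"
    then have ps: "p * s \<in> {0..h}" using s by (auto simp: field_simps)
    have "I S D (p * s) \<le> Q S D" unfolding Q_def h using ps bdd by (rule cSUP_upper)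
    then have "Min (products S D (p * s)) \<le> s\<^sup>2" using Q by (simp add: I_eq_Min_products)
    then obtain i j where ij: "i \<in> set (indices TX S)" "j \<in> set (indices RX S)"
      and le: "\<bar>pos D i - p * s\<bar> * \<bar>pos D j - p * s\<bar> \<le> s\<^sup>2"
      using Min_in[OF finite_products nonempty, of "p * s"] by (auto simp: products_def set_indices)
    have eq: "\<bar>p - x / s\<bar> = \<bar>x - p * s\<bar> / s" for x
    proof -
      have "p - x / s = (p * s - x) / s" using s by (simp add: field_simps)
      then show ?thesis using s by (simp add: abs_minus_commute)
    qed
    have "\<bar>p - pos D i / s\<bar> * \<bar>p - pos D j / s\<bar> \<le> 1"
      unfolding eq using le s by (simp add: power2_eq_square)
    then show "\<exists>t\<in>set (map (\<lambda>k. pos D k / s) (indices TX S)).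
      \<exists>r\<in>set (map (\<lambda>k. pos D k / s) (indices RX S)). \<bar>p - t\<bar> * \<bar>p - r\<bar> \<le> 1"
      using ij by auto
  qed
  then show ?thesis
    unfolding covering_def using sorted bounds s by (auto simp: divide_right_mono)
qed

section \<open>Optimality of an explicit placement\<close>

definition covers_at :: "node list \<Rightarrow> (nat \<Rightarrow> real) \<Rightarrow> real \<Rightarrow> bool" where
  "covers_at S X p \<longleftrightarrow> (\<exists>i<length S. \<exists>j<length S.
     type_of (S ! i) = TX \<and> type_of (S ! j) = RX \<and> \<bar>X i - p\<bar> * \<bar>X j - p\<bar> \<le> 1)"

text \<open>Scaling a longest covering, of length \<open>H\<close>, to length \<open>h\<close>
  multiplies products by the square of \<open>h / H\<close>. Any smaller value of \<open>Q\<close>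
  would scale back to a covering longer than \<open>H\<close>.\<close>

lemma optimal_order_of_placement:
  assumes dep: "deployment_order M N S" and MN: "1 \<le> M" "1 \<le> N" and h: "0 < h" and H: "0 < H"
    and X: "X 0 = 0" "X (M + N + 1) = H" "\<And>k. k \<le> M + N \<Longrightarrow> X k \<le> X (Suc k)"
    and cov: "\<And>k p. k \<le> M + N \<Longrightarrow> X k \<le> p \<Longrightarrow> p \<le> X (Suc k) \<Longrightarrow> covers_at S X p"
    and bound: "\<And>ts rs L. covering ts rs L \<Longrightarrow> length ts = M \<Longrightarrow> length rs = N \<Longrightarrow> L \<le> H"
  shows "optimal_order M N h S"
proof -
  define s where "s = h / H"
  have s: "0 < s" using h H by (simp add: s_def)
  define D where "D = map (\<lambda>k. s * (X (Suc k) - X k)) [0..<M + N + 1]"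
  have posD: "pos D k = s * X k" if "k \<le> M + N + 1" for k
  proof -
    have "pos D k = (\<Sum>i<k. s * (X (Suc i) - X i))"
      using that by (simp add: pos_def D_def take_map take_upt interv_sum_list_conv_sum_set_nat
          atLeast0LessThan del: upt_Suc)
    also have "\<dots> = s * X k" using X(1) by (simp add: sum_distrib_left[symmetric] sum_lessThan_telescope)
    finally show ?thesis .
  qed
  have sumD: "sum_list D = h"
    using posD[of "M + N + 1"] X(2) H by (simp add: pos_def D_def s_def del: upt_Suc)
  have spD: "spacings S h D"
    unfolding spacings_def using sumD deployment_order_length(1)[OF dep] X(3) s
    by (auto simp: D_def simp del: upt_Suc)
  have "\<exists>k\<le>n. X k \<le> p \<and> p \<le> X (Suc k)" if "0 \<le> p" "p \<le> X (Suc n)" for p n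
    using that
  proof (induction n)
    case 0
    then show ?case using X(1) by auto
  next
    case (Suc n)
    show ?case
    proof (cases "p \<le> X (Suc n)")
      case True
      then show ?thesis using Suc le_SucI by blast
    next
      case False
      then show ?thesis using Suc.prems by (intro exI[of _ "Suc n"]) auto
    qed
  qed
  then have covp: "covers_at S X p" if "0 \<le> p" "p \<le> H" for p
    using that X(2) cov by (metis Suc_eq_plus1)
  have "Q S D \<le> s\<^sup>2"
    unfolding Q_def sumD
  proof (rule cSUP_least)
    fix p assume p: "p \<in> {0..h}"
    have "covers_at S X (p / s)" using p s h H by (intro covp) (auto simp: s_def field_simps)
    then obtain i j where ij: "i < length S" "j < length S" "type_of (S ! i) = TX" "type_of (S ! j) = RX"
      and le: "\<bar>X i - p / s\<bar> * \<bar>X j - p / s\<bar> \<le> 1" by (auto simp: covers_at_def)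
    have eq: "\<bar>s * x - p\<bar> = s * \<bar>x - p / s\<bar>" for x
    proof -
      have "s * x - p = s * (x - p / s)" using s by (simp add: field_simps)
      then show ?thesis using s by (simp add: abs_mult)
    qed
    have "\<bar>pos D i - p\<bar> * \<bar>pos D j - p\<bar> = s\<^sup>2 * (\<bar>X i - p / s\<bar> * \<bar>X j - p / s\<bar>)"
      using ij deployment_order_length(1)[OF dep] by (simp add: posD eq power2_eq_square)
    also have "\<dots> \<le> s\<^sup>2" using le by (simp add: mult_left_le)
    finally have "\<bar>pos D i - p\<bar> * \<bar>pos D j - p\<bar> \<le> s\<^sup>2" .
    moreover have "\<bar>pos D i - p\<bar> * \<bar>pos D j - p\<bar> \<in> products S D p"
      using ij by (auto simp: products_def)
    ultimately show "I S D p \<le> s\<^sup>2"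
      unfolding I_eq_Min_products by (meson Min_le finite_products order_trans)
  qed (use h in simp)
  moreover have "s\<^sup>2 \<le> Q S' D'" if S': "deployment_order M N S'" "spacings S' h D'" for S' D'
  proof (rule ccontr)
    assume "\<not> s\<^sup>2 \<le> Q S' D'"
    then have "sqrt (Q S' D') < sqrt (s\<^sup>2)" by (intro real_sqrt_less_mono) simp
    then have less: "sqrt (Q S' D') < s" using s by simp
    \<comment> \<open>The maximum with \<open>s / 2\<close> keeps \<open>c\<close> positive even if
      \<open>Q S' D'\<close> were zero or negative, and \<open>c\<close> stays below
      \<open>s\<close>.\<close>
    define c where "c = max (sqrt (Q S' D')) (s / 2)"
    have c: "0 < c" "c < s" using less s by (auto simp: c_def)
    have "Q S' D' \<le> c\<^sup>2"
    proof (cases "0 \<le> Q S' D'")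
      case True
      then have "(sqrt (Q S' D'))\<^sup>2 \<le> c\<^sup>2" by (intro power_mono) (auto simp: c_def)
      then show ?thesis using True by simp
    next
      case False
      then show ?thesis using zero_le_power2[of c] by linarith
    qed
    from covering_of_Q_le[OF S' MN this c(1)] have "h / c \<le> H"
      by (rule bound) (use deployment_order_length[OF S'(1)] in auto)
    then have "h \<le> H * c" using c by (simp add: field_simps)
    also have "\<dots> < H * s" using c H by simp
    also have "\<dots> = h" using H by (simp add: s_def)
    finally show False by simp
  qed
  ultimately show ?thesis
    unfolding optimal_order_def using dep spD order_trans by blast
qed

section \<open>Zones of a deployment order\<close>

definition zone_size :: "nat \<Rightarrow> node list \<Rightarrow> nat \<Rightarrow> nat" where
  "zone_size M S i = (if i = 0 then n_first S else if i = M then n_last M S else n_mid S i)"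

text \<open>With the end nodes added to the transmitter indices, every zone lies strictly between
  consecutive values of \<open>T\<close> and contains receivers only, so its size is an index
  difference.\<close>

lemma order_positions:
  assumes dep: "deployment_order M N S" and M: "1 \<le> M"
  obtains T where "T 0 = 0" "T (M + 1) = M + N + 1"
    and "\<And>i. i \<le> M \<Longrightarrow> T (Suc i) = T i + zone_size M S i + 1"
    and "\<And>k. type_of (S ! k) = TX \<and> k < length S \<longleftrightarrow> k \<in> T ` {1..M}"
    and "\<And>k. type_of (S ! k) = RX \<and> k < length S \<longleftrightarrow> 0 < k \<and> k \<le> M + N \<and> k \<notin> T ` {1..M}"
proof -
  let ?l = "indices TX S"
  note len = deployment_order_length[OF dep]
  define T where "T i = (if i = 0 then 0 else if i = M + 1 then M + N + 1 else tx_index S i)" for i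
  have sl: "sorted_wrt (<) ?l" by (simp add: indices_def sorted_wrt_filter)
  have Tnth: "T i = ?l ! (i - 1)" if "1 \<le> i" "i \<le> M" for i
    using that by (simp add: T_def tx_index_def indices_def)
  have imgT: "T ` {1..M} = set ?l"
  proof -
    have "T ` {1..M} = (\<lambda>i. ?l ! (i - 1)) ` {1..M}" using Tnth by (intro image_cong) auto
    also have "\<dots> = (!) ?l ` {..<M}"
    proof -
      have "(\<lambda>i. i - 1) ` {1..M} = {..<M}"
      proof (intro equalityI subsetI)
        fix x assume "x \<in> {..<M}"
        then show "x \<in> (\<lambda>i. i - 1) ` {1..M}" by (intro image_eqI[of _ _ "Suc x"]) auto
      qed (use M in auto)
      then show ?thesis by (metis image_image)
    qed
    also have "\<dots> = set ?l" using len by (auto simp: in_set_conv_nth image_iff)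
    finally show ?thesis .
  qed
  have TX: "type_of (S ! k) = TX \<and> k < length S \<longleftrightarrow> k \<in> T ` {1..M}" for k
    unfolding imgT set_indices by auto
  have RX: "type_of (S ! k) = RX \<and> k < length S \<longleftrightarrow> 0 < k \<and> k \<le> M + N \<and> k \<notin> T ` {1..M}" for k
    using deployment_order_nth[OF dep, of k] TX[of k] len(1) by (cases "type_of (S ! k)") auto
  have range: "0 < T i \<and> T i \<le> M + N" if "1 \<le> i" "i \<le> M" for i
  proof -
    have "T i \<in> T ` {1..M}" using that by auto
    then have "type_of (S ! T i) = TX" "T i < length S" using TX by auto
    then show ?thesis using deployment_order_nth[OF dep, of "T i"] by auto
  qed
  have mono: "T i < T j" if "1 \<le> i" "i < j" "j \<le> M" for i j
    using that len sl Tnth[of i] Tnth[of j] by (simp add: sorted_wrt_nth_less)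
  have mono': "T i < T j" if "i < j" "j \<le> M + 1" for i j
    using mono[of i j] range[of i] range[of j] that M by (cases "i = 0"; cases "j = M + 1") (auto simp: T_def)
  have between: "receivers_between S (T i) (T (Suc i)) = T (Suc i) - T i - 1" if i: "i \<le> M" for i
  proof -
    have "{k. T i < k \<and> k < T (Suc i) \<and> type_of (S ! k) = RX} = {T i<..<T (Suc i)}"
    proof -
      have "type_of (S ! k) = RX" if k: "T i < k" "k < T (Suc i)" for k
      proof -
        have "T (Suc i) \<le> M + N + 1"
          using range[of "Suc i"] i by (cases "i = M") (auto simp: T_def)
        moreover have "k \<notin> T ` {1..M}"
        proof
          assume "k \<in> T ` {1..M}"
          then obtain j where j: "1 \<le> j" "j \<le> M" "k = T j" by auto
          have "\<not> j \<le> i" using mono'[of j i] j k i by (cases "j = i") auto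
          moreover have "\<not> Suc i \<le> j" using mono'[of "Suc i" j] j k by (cases "j = Suc i") auto
          ultimately show False by simp
        qed
        ultimately show ?thesis using RX[of k] k by auto
      qed
      then show ?thesis by auto
    qed
    then show ?thesis by (simp add: receivers_between_def)
  qed
  show ?thesis
  proof (rule that[of T])
    show "T 0 = 0" "T (M + 1) = M + N + 1" by (auto simp: T_def)
    fix i assume i: "i \<le> M"
    have "zone_size M S i = receivers_between S (T i) (T (Suc i))"
      using i M len(1) by (auto simp: zone_size_def n_first_def n_last_def n_mid_def T_def)
    then show "T (Suc i) = T i + zone_size M S i + 1"
      using between[OF i] mono'[of i "Suc i"] i by simp
  qed (use TX RX in blast)+
qed

section \<open>Spacings attaining the bounds\<close>

lemma gap_nonneg: "0 \<le> gap k"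
  using gap_pos[of k] by simp

lemma sum_gap: "(\<Sum>u<j. gap u) = 2 * sqrt j"
  by (induction j) (simp_all add: gap_def algebra_simps)

lemma sum_rev_lessThan:
  fixes f :: "nat \<Rightarrow> 'a::comm_monoid_add"
  shows "(\<Sum>u<j. f (j - 1 - u)) = (\<Sum>u<j. f u)"
  by (rule sum.reindex_bij_witness[of _ "\<lambda>u. j - 1 - u" "\<lambda>u. j - 1 - u"]) auto

text \<open>With a transmitter at 0 and receivers at \<open>2 * sqrt u\<close> and
  \<open>2 * sqrt (u + 1)\<close>, the nearer receiver covers \<open>q\<close>; at their midpoint
  the product is exactly 1. For \<open>u = 0\<close> the left node is the transmitter itself, and
  \<open>q * (2 - q) \<le> 1\<close> is used.\<close>

lemma product_le_one:
  assumes "2 * sqrt (real u) \<le> q" "q \<le> 2 * sqrt (real u + 1)"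
  shows "q * (2 * sqrt (real u + 1) - q) \<le> 1 \<or> 0 < u \<and> q * (q - 2 * sqrt (real u)) \<le> 1"
proof -
  define a b where "a = 2 * sqrt (real u)" and "b = 2 * sqrt (real u + 1)"
  have a: "0 \<le> a" "a \<le> q" "q \<le> b" using assms by (auto simp: a_def b_def)
  have sq: "b\<^sup>2 - a\<^sup>2 = 4" by (simp add: a_def b_def power_mult_distrib)
  show ?thesis
  proof (cases "q \<le> (a + b) / 2 \<and> 0 < u")
    case True
    then have "q * (q - a) \<le> ((a + b) / 2) * ((b - a) / 2)"
      using a by (intro mult_mono) (auto simp: field_simps)
    also have "\<dots> = 1" using sq by (simp add: power2_eq_square field_simps)
    finally show ?thesis using True by (simp add: a_def)
  next
    case outer: False
    have "q * (b - q) \<le> 1"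
    proof (cases "u = 0")
      case True
      have "0 \<le> (q - 1) * (q - 1)" by simp
      then show ?thesis using True by (simp add: b_def algebra_simps)
    next
      case False
      with outer have q: "(a + b) / 2 \<le> q" by simp
      have "0 \<le> (q - (a + b) / 2) * (q + (a + b) / 2 - b)"
        using q a by (intro mult_nonneg_nonneg) (auto simp: field_simps)
      then show ?thesis using sq by (simp add: power2_eq_square field_simps)
    qed
    then show ?thesis by (simp add: b_def)
  qed
qed

text \<open>
  Spacing to the right of the \<open>u\<close>-th node of zone \<open>i\<close>; it depends on the number of receivers separating
  this gap from the closer transmitter, and the virtual end nodes act as mirrors.
\<close>

definition zone_gap :: "nat \<Rightarrow> (nat \<Rightarrow> nat) \<Rightarrow> nat \<Rightarrow> nat \<Rightarrow> real" where
  "zone_gap M n i u =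
    (if i = 0 then if u = 0 then gap (n 0) / 2 else gap (n 0 - u)
     else if i = M then if u = n M then gap (n M) / 2 else gap u
     else gap (min u (n i - u)))"

text \<open>
  In the proof, \<open>T 1, \<dots>, T M\<close> are the indices of the transmitters and \<open>T 0\<close>, \<open>T (M + 1)\<close> those of the
  end nodes, so that zone \<open>i\<close> consists of the indices \<open>T i + u\<close> with \<open>u \<le> n i\<close>.
\<close>

lemma balanced_optimal:
  assumes dep: "deployment_order M N S" and MN: "1 \<le> M" "1 \<le> N" and h: "0 < h"
    and bal: "balanced M (zone_size M S)" and sum: "(\<Sum>i\<le>M. zone_size M S i) = N"
    and ge1: "\<And>i. i \<le> M \<Longrightarrow> 1 \<le> zone_size M S i"
  shows "optimal_order M N h S"
proof -
  define n where "n = zone_size M S"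
  obtain T where T0: "T 0 = 0" and TM: "T (M + 1) = M + N + 1"
    and TS: "\<And>i. i \<le> M \<Longrightarrow> T (Suc i) = T i + n i + 1"
    and TX: "\<And>k. type_of (S ! k) = TX \<and> k < length S \<longleftrightarrow> k \<in> T ` {1..M}"
    and RX: "\<And>k. type_of (S ! k) = RX \<and> k < length S \<longleftrightarrow> 0 < k \<and> k \<le> M + N \<and> k \<notin> T ` {1..M}"
    unfolding n_def using order_positions[OF dep MN(1)] by metis
  have Tmono: "T i \<le> T j" if "i \<le> j" "j \<le> M + 1" for i j
    using that
  proof (induction rule: dec_induct)
    case (step k)
    then show ?case using TS[of k] by simp
  qed simp
  define zone where "zone k = (LEAST i. k < T (Suc i))" for k
  have zone: "zone (T i + u) = i" if "i \<le> M" "u \<le> n i" for i u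
    unfolding zone_def
  proof (rule Least_equality)
    show "T i + u < T (Suc i)" using TS that by simp
    fix j assume "T i + u < T (Suc j)"
    then have "\<not> Suc j \<le> i" using Tmono[of "Suc j" i] that by auto
    then show "i \<le> j" by simp
  qed
  have locate: "\<exists>i\<le>M. \<exists>u\<le>n i. k = T i + u" if "k \<le> M + N" for k
  proof -
    have "k < T (Suc M)" using TM that by simp
    define i where "i = zone k"
    have k: "k < T (Suc i)" unfolding i_def zone_def by (rule LeastI) fact
    have iM: "i \<le> M" unfolding i_def zone_def by (rule Least_le) fact
    have "T i \<le> k"
    proof (cases i)
      case 0
      then show ?thesis using T0 by simp
    next
      case (Suc j)
      have "\<not> k < T (Suc j)" by (rule not_less_Least) (use Suc in \<open>simp add: i_def zone_def\<close>)
      then show ?thesis using Suc by simp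
    qed
    then show ?thesis using k iM TS[OF iM] by (intro exI[of _ i] conjI exI[of _ "k - T i"]) auto
  qed
  define d where "d k = zone_gap M n (zone k) (k - T (zone k))" for k
  have d: "d (T i + u) = zone_gap M n i u" if "i \<le> M" "u \<le> n i" for i u
    using zone[OF that] by (simp add: d_def)
  define X where "X k = (\<Sum>j<k. d j)" for k
  have d0: "0 \<le> d k" for k
    by (simp add: d_def zone_gap_def gap_nonneg)
  have XS: "X (Suc k) = X k + d k" for k by (simp add: X_def)
  have Xadd: "X (a + j) = X a + (\<Sum>u<j. d (a + u))" for a j
    by (induction j) (simp_all add: X_def)
  \<comment> \<open>Spacings counted from a transmitter telescope to square roots:
    \<open>left\<close> counts from the left boundary of a zone, \<open>right\<close> from the right
    one.\<close>
  have left: "X (T i + j) = X (T i) + 2 * sqrt j"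
    if "i \<le> M" "j \<le> n i + 1" "\<And>u. u < j \<Longrightarrow> zone_gap M n i u = gap u" for i j
  proof -
    have "(\<Sum>u<j. d (T i + u)) = (\<Sum>u<j. gap u)"
      using that by (intro sum.cong) (auto simp: d)
    then show ?thesis using Xadd sum_gap by simp
  qed
  have right: "X (T (Suc i) - j) = X (T (Suc i)) - 2 * sqrt j"
    if "i \<le> M" "j \<le> n i + 1" "\<And>u. u < j \<Longrightarrow> zone_gap M n i (n i - u) = gap u" for i j
  proof -
    let ?a = "T (Suc i) - j"
    have a: "?a + j = T (Suc i)" using that TS[of i] by simp
    have "(\<Sum>u<j. d (?a + u)) = (\<Sum>u<j. gap (j - 1 - u))"
    proof (rule sum.cong)
      fix u assume "u \<in> {..<j}"
      then have u: "u < j" by simp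
      have "?a + u = T i + (n i - (j - 1 - u))" using u that TS[of i] by simp
      then have "d (?a + u) = zone_gap M n i (n i - (j - 1 - u))"
        using d[OF that(1), of "n i - (j - 1 - u)"] by simp
      then show "d (?a + u) = gap (j - 1 - u)" using that(3)[of "j - 1 - u"] u by simp
    qed simp
    then show ?thesis using Xadd[of ?a j] a sum_gap[of j] sum_rev_lessThan[of gap j] by simp
  qed
  have ge1': "1 \<le> n i" if "i \<le> M" for i using ge1 that by (simp add: n_def)
  have gap0: "zone_gap M n 0 (n 0 - u) = gap u" if "u < n 0" for u
    using that by (auto simp: zone_gap_def)
  have gapM: "zone_gap M n M u = gap u" if "u < n M" for u
    using that MN by (auto simp: zone_gap_def)
  have gapl: "zone_gap M n i u = gap u" if "0 < i" "i < M" "2 * u \<le> n i" for i u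
    using that by (simp add: zone_gap_def min_absorb1)
  have gapr: "zone_gap M n i (n i - u) = gap u" if "0 < i" "i < M" "2 * u \<le> n i" for i u
    using that by (simp add: zone_gap_def min_absorb2)
  have half: "2 * sqrt (real m) + gap m / 2 = end_len m" for m
    by (simp add: end_len_def gap_def field_simps)
  have len0: "X (T 1) = end_len (n 0)" and X1: "X 1 = gap (n 0) / 2"
  proof -
    show X1: "X 1 = gap (n 0) / 2" using d[of 0 0] T0 by (simp add: X_def zone_gap_def)
    have "X (T 1 - n 0) = X (T 1) - 2 * sqrt (n 0)" using right[of 0 "n 0"] gap0 by simp
    moreover have "T 1 - n 0 = 1" using TS[of 0] T0 by simp
    ultimately show "X (T 1) = end_len (n 0)" using X1 half[of "n 0"] by simp
  qed
  have lenM: "X (T (Suc M)) = X (T M) + end_len (n M)"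
    and XM: "X (T M + n M) = X (T M) + 2 * sqrt (n M)"
  proof -
    show XM: "X (T M + n M) = X (T M) + 2 * sqrt (n M)" using left[of M "n M"] gapM by simp
    have "d (T M + n M) = gap (n M) / 2" using d[of M "n M"] MN by (simp add: zone_gap_def)
    then show "X (T (Suc M)) = X (T M) + end_len (n M)"
      using TS[of M] XS[of "T M + n M"] XM half[of "n M"] by simp
  qed
  have leni: "X (T (Suc i)) = X (T i) + zone_len (n i)" if i: "0 < i" "i < M" for i
  proof -
    \<comment> \<open>Since \<open>?j + ?j' = n i + 1\<close>, counting \<open>?j\<close> spacings
      from the left and \<open>?j'\<close> from the right ends at the same node, where both formulas
      are joined.\<close>
    let ?j = "n i div 2 + 1" and ?j' = "(n i + 1) div 2"
    have "X (T i + ?j) = X (T i) + 2 * sqrt ?j" using i by (intro left gapl) auto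
    moreover have "X (T (Suc i) - ?j') = X (T (Suc i)) - 2 * sqrt ?j'" using i by (intro right gapr) auto
    moreover have "T i + ?j = T (Suc i) - ?j'" using TS[of i] i by simp
    ultimately show ?thesis by (simp add: zone_len_def)
  qed
  have "X (T (Suc M)) - X (T 0) = (\<Sum>i\<le>M. X (T (Suc i)) - X (T i))"
    using sum_lessThan_telescope[of "\<lambda>i. X (T i)" "Suc M"] unfolding lessThan_Suc_atMost by simp
  also have "\<dots> = total_len M n"
    unfolding sum_atMost_split_ends[OF MN(1)] total_len_def using len0 lenM leni T0
    by (simp add: X_def)
  finally have XH: "X (M + N + 1) = total_len M n" using TM T0 by (simp add: X_def)
  have isT: "type_of (S ! T i) = TX" "T i < length S" if "1 \<le> i" "i \<le> M" for i
    using TX[of "T i"] that by auto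
  have isR: "type_of (S ! (T i + u)) = RX" "T i + u < length S" if "i \<le> M" "1 \<le> u" "u \<le> n i" for i u
  proof -
    have "T i + u \<notin> T ` {1..M}"
    proof
      assume "T i + u \<in> T ` {1..M}"
      then obtain j where j: "j \<le> M" "T i + u = T j" by auto
      show False using zone[OF that(1,3)] zone[OF j(1), of 0] j that by simp
    qed
    moreover have "T i + u \<le> M + N"
      using TS[OF that(1)] Tmono[of "Suc i" "M + 1"] TM that by simp
    ultimately have "type_of (S ! (T i + u)) = RX \<and> T i + u < length S"
      using RX[of "T i + u"] that by simp
    then show "type_of (S ! (T i + u)) = RX" "T i + u < length S" by auto
  qed
  have coversI: "covers_at S X p"
    if "1 \<le> i" "i \<le> M" "j \<le> M" "1 \<le> u" "u \<le> n j" "\<bar>X (T i) - p\<bar> * \<bar>X (T j + u) - p\<bar> \<le> 1" for i j u p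
    unfolding covers_at_def using isT[OF that(1,2)] isR[OF that(3-5)] that(6) by blast
  have cover_left: "covers_at S X p"
    if "1 \<le> i" "i \<le> M" "u < n i" "X (T i + u) \<le> p" "p \<le> X (T i + Suc u)"
      "\<And>v. v \<le> u \<Longrightarrow> zone_gap M n i v = gap v" for i u p
  proof -
    have x: "X (T i + u) = X (T i) + 2 * sqrt u" "X (T i + Suc u) = X (T i) + 2 * sqrt (real u + 1)"
      using left[of i u] left[of i "Suc u"] that by (auto simp: add.commute)
    define q where "q = p - X (T i)"
    have q: "2 * sqrt (real u) \<le> q" "q \<le> 2 * sqrt (real u + 1)" using that(4,5) x by (auto simp: q_def)
    have q0: "0 \<le> q" using q(1) order_trans[of 0 "2 * sqrt (real u)"] by simp
    have dist: "\<bar>X (T i) - p\<bar> = q" "\<bar>X (T i + Suc u) - p\<bar> = 2 * sqrt (real u + 1) - q"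
      "\<bar>X (T i + u) - p\<bar> = q - 2 * sqrt (real u)"
      unfolding x using q q0 by (auto simp: q_def)
    from product_le_one[OF q] show ?thesis
    proof
      assume "q * (2 * sqrt (real u + 1) - q) \<le> 1"
      then have "\<bar>X (T i) - p\<bar> * \<bar>X (T i + Suc u) - p\<bar> \<le> 1" unfolding dist .
      then show ?thesis using coversI[of i i "Suc u"] that by simp
    next
      assume "0 < u \<and> q * (q - 2 * sqrt (real u)) \<le> 1"
      then have "0 < u" "\<bar>X (T i) - p\<bar> * \<bar>X (T i + u) - p\<bar> \<le> 1" unfolding dist by auto
      then show ?thesis using coversI[of i i u] that by simp
    qed
  qed
  have cover_right: "covers_at S X p"
    if "i < M" "0 < u" "u \<le> n i" "X (T i + u) \<le> p" "p \<le> X (T i + Suc u)"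
      "\<And>v. v \<le> n i - u \<Longrightarrow> zone_gap M n i (n i - v) = gap v" for i u p
  proof -
    define v where "v = n i - u"
    have eq: "T (Suc i) - v = T i + Suc u" "T (Suc i) - Suc v = T i + u"
      using TS[of i] that by (auto simp: v_def)
    have x: "X (T i + Suc u) = X (T (Suc i)) - 2 * sqrt v" "X (T i + u) = X (T (Suc i)) - 2 * sqrt (real v + 1)"
      using right[of i v] right[of i "Suc v"] that unfolding eq by (auto simp: v_def add.commute)
    define q where "q = X (T (Suc i)) - p"
    have q: "2 * sqrt (real v) \<le> q" "q \<le> 2 * sqrt (real v + 1)" using that(4,5) x by (auto simp: q_def)
    have q0: "0 \<le> q" using q(1) order_trans[of 0 "2 * sqrt (real v)"] by simp
    have dist: "\<bar>X (T (Suc i)) - p\<bar> = q" "\<bar>X (T i + u) - p\<bar> = 2 * sqrt (real v + 1) - q"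
      "\<bar>X (T i + Suc u) - p\<bar> = q - 2 * sqrt (real v)"
      unfolding x using q q0 by (auto simp: q_def)
    from product_le_one[OF q] show ?thesis
    proof
      assume "q * (2 * sqrt (real v + 1) - q) \<le> 1"
      then have "\<bar>X (T (Suc i)) - p\<bar> * \<bar>X (T i + u) - p\<bar> \<le> 1" unfolding dist .
      then show ?thesis using coversI[of "Suc i" i u] that by simp
    next
      assume "0 < v \<and> q * (q - 2 * sqrt (real v)) \<le> 1"
      then have "0 < v" "\<bar>X (T (Suc i)) - p\<bar> * \<bar>X (T i + Suc u) - p\<bar> \<le> 1" unfolding dist by auto
      then show ?thesis using coversI[of "Suc i" i "Suc u"] that by (simp add: v_def)
    qed
  qed
  \<comment> \<open>These are the distances from an end node to its nearest transmitter and
    receiver: sum and difference of the same two roots, so the end node meets the threshold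
    exactly.\<close>
  have end_product: "end_len m * (gap m / 2) = 1" for m
    by (simp add: end_len_def gap_def algebra_simps)
  show ?thesis
  proof (rule optimal_order_of_placement[where X = X, OF dep MN h])
    show "X 0 = 0" by (simp add: X_def)
    show "X (M + N + 1) = total_len M n" by (rule XH)
    show "0 < total_len M n"
    proof -
      have "0 < end_len (n 0)" "0 \<le> end_len (n M)" by (auto simp: end_len_def add_nonneg_pos)
      moreover have "0 \<le> (\<Sum>i\<in>{1..<M}. zone_len (n i))" by (intro sum_nonneg) (simp add: zone_len_def)
      ultimately show ?thesis by (simp add: total_len_def)
    qed
    show "X k \<le> X (Suc k)" for k using XS d0 by simp
    show "L \<le> total_len M n" if "covering ts rs L" "length ts = M" "length rs = N" for ts rs L
      using covering_le_balanced[OF bal MN(1) sum that] by (simp add: n_def)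
  next
    fix k p assume k: "k \<le> M + N" "X k \<le> p" "p \<le> X (Suc k)"
    obtain i u where iu: "i \<le> M" "u \<le> n i" "k = T i + u" using locate[OF k(1)] by blast
    have p: "X (T i + u) \<le> p" "p \<le> X (T i + Suc u)" using k iu by auto
    \<comment> \<open>The two outermost spacings use \<open>end_product\<close>; every other point
      is covered from the transmitter with fewer receivers in between.\<close>
    consider (start) "i = 0" "u = 0" | (first) "i = 0" "0 < u" | (last) "i = M" "u < n M"
      | (stop) "i = M" "u = n M" | (low) "0 < i" "i < M" "2 * u \<le> n i"
      | (high) "0 < i" "i < M" "n i < 2 * u"
      using iu MN by force
    then show "covers_at S X p"
    proof cases
      case start
      then have p: "0 \<le> p" "p \<le> gap (n 0) / 2" using p T0 X1 by (auto simp: X_def)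
      have "(end_len (n 0) - p) * (gap (n 0) / 2 - p) \<le> end_len (n 0) * (gap (n 0) / 2)"
        using p half[of "n 0"] by (intro mult_mono) (auto simp: end_len_def)
      moreover have "gap (n 0) / 2 \<le> end_len (n 0)"
        using half[of "n 0"] real_sqrt_ge_zero[of "real (n 0)"] by linarith
      then have "\<bar>X (T 1) - p\<bar> = end_len (n 0) - p" "\<bar>X (T 0 + 1) - p\<bar> = gap (n 0) / 2 - p"
        using p len0 X1 T0 by auto
      ultimately have "\<bar>X (T 1) - p\<bar> * \<bar>X (T 0 + 1) - p\<bar> \<le> 1"
        using end_product[of "n 0"] by simp
      then show ?thesis using coversI[of 1 0 1] MN ge1'[of 0] by simp
    next
      case first
      then show ?thesis using cover_right[of 0 u p] iu p gap0 MN by auto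
    next
      case last
      then show ?thesis using cover_left[of M u p] iu p gapM MN by auto
    next
      case stop
      define q where "q = p - X (T M)"
      have q: "2 * sqrt (n M) \<le> q" "q \<le> end_len (n M)"
        using p stop XM lenM TS[of M] by (auto simp: q_def)
      then have q0: "0 \<le> q" using order_trans[of 0 "2 * sqrt (real (n M))" q] by simp
      have "q * (q - 2 * sqrt (n M)) \<le> end_len (n M) * (end_len (n M) - 2 * sqrt (n M))"
        using q q0 by (intro mult_mono) auto
      also have "\<dots> = 1" using end_product[of "n M"] half[of "n M"] by (metis add_diff_cancel_left')
      finally have "q * (q - 2 * sqrt (n M)) \<le> 1" .
      moreover have "\<bar>X (T M) - p\<bar> = q" "\<bar>X (T M + n M) - p\<bar> = q - 2 * sqrt (n M)"
        unfolding XM using q q0 by (auto simp: q_def)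
      ultimately have "\<bar>X (T M) - p\<bar> * \<bar>X (T M + n M) - p\<bar> \<le> 1" by simp
      then show ?thesis using coversI[of M M "n M"] MN ge1'[of M] by simp
    next
      case low
      \<comment> \<open>A nonempty zone guarantees that the right neighbour is a receiver rather
        than the next transmitter.\<close>
      then have "u < n i" using ge1'[of i] by simp
      then show ?thesis using cover_left[of i u p] low p gapl by auto
    next
      case high
      then show ?thesis using cover_right[of i u p] iu p gapr by auto
    qed
  qed
qed

section \<open>The alternating order\<close>

lemma alternating_optimal:
  assumes dep: "deployment_order M M S" and M: "1 \<le> M" and h: "0 < h"
    and alt: "\<And>k. 0 < k \<Longrightarrow> k < 2 * M \<Longrightarrow>
      {type_of (S ! k), type_of (S ! Suc k)} = {TX, RX}"
  shows "optimal_order M M h S"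
proof -
  \<comment> \<open>The positive root of \<open>x * (x + 2) = 1\<close>: an end node is at distances
    \<open>x\<close> and \<open>x + 2\<close> from its two nearest nodes, which have opposite
    types.\<close>
  define x where "x = sqrt 2 - 1"
  define H where "H = 4 * real M - 4 + 2 * sqrt 2"
  define X where "X k = (if k = 0 then 0 else if k = 2 * M + 1 then H else x + 2 * (real k - 1))" for k
  have x: "0 < x" "x * (x + 2) = 1" by (auto simp: x_def algebra_simps)
  have H: "H = x + 2 * (real (2 * M) - 1) + x" by (simp add: H_def x_def)
  have mid: "X k = x + 2 * (real k - 1)" if "0 < k" "k \<le> 2 * M" for k
    using that by (simp add: X_def)
  have len: "length S = 2 * M + 2" using deployment_order_length[OF dep] by simp
  have coversI: "covers_at S X p"
    if k: "0 < k" "k < 2 * M" and le: "\<bar>X k - p\<bar> * \<bar>X (Suc k) - p\<bar> \<le> 1" for k p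
  proof -
    consider "type_of (S ! k) = TX" "type_of (S ! Suc k) = RX"
      | "type_of (S ! k) = RX" "type_of (S ! Suc k) = TX"
      using alt[OF k] by (auto simp: doubleton_eq_iff)
    then show ?thesis
    proof cases
      case 1
      then show ?thesis unfolding covers_at_def using le k len
        by (intro exI[of _ k] exI[of _ "Suc k"] conjI) auto
    next
      case 2
      then show ?thesis unfolding covers_at_def using le k len
        by (intro exI[of _ "Suc k"] exI[of _ k] conjI) (auto simp: mult.commute)
    qed
  qed
  show ?thesis
  proof (rule optimal_order_of_placement[OF dep M M h])
    show "0 < H" using H x M by simp
    show "X 0 = 0" "X (M + M + 1) = H" by (auto simp: X_def)
    show "X k \<le> X (Suc k)" if "k \<le> M + M" for k
      using that x M by (auto simp: X_def H)
    show "L \<le> H" if "covering ts rs L" "length ts = M" "length rs = M" for ts rs L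
      using covering_equal_le[OF that M] by (simp add: H_def)
  next
    fix k p assume k: "k \<le> M + M" "X k \<le> p" "p \<le> X (Suc k)"
    consider "k = 0" | "0 < k" "k < 2 * M" | "k = 2 * M" using k(1) by linarith
    then show "covers_at S X p"
    proof cases
      case 1
      then have p: "0 \<le> p" "p \<le> x" using k M by (auto simp: X_def)
      then have "(x - p) * (x + 2 - p) \<le> x * (x + 2)" by (intro mult_mono) auto
      then have "\<bar>X 1 - p\<bar> * \<bar>X (Suc 1) - p\<bar> \<le> 1" using p x M mid[of 1] mid[of "Suc 1"] by simp
      then show ?thesis using coversI[of 1] M by simp
    next
      case 2
      define q where "q = p - X k - 1"
      have eq: "X (Suc k) = X k + 2" using mid[of k] mid[of "Suc k"] 2 by simp
      have "\<bar>X k - p\<bar> * \<bar>X (Suc k) - p\<bar> = (1 + q) * (1 - q)"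
        using k(2,3) eq by (simp add: q_def)
      also have "\<dots> \<le> 1" by (simp add: algebra_simps)
      finally show ?thesis using coversI[of k] 2 by simp
    next
      case 3
      define q where "q = p - X (2 * M)"
      have "X (2 * M) + x = H" using mid[of "2 * M"] M H by simp
      then have q: "0 \<le> q" "q \<le> x" using k 3 by (auto simp: q_def X_def)
      have eq: "X (2 * M) = X (2 * M - 1) + 2"
        using mid[of "2 * M"] mid[of "2 * M - 1"] M by (simp add: of_nat_diff)
      have "q * (q + 2) \<le> x * (x + 2)" using q by (intro mult_mono) auto
      then have "\<bar>X (2 * M - 1) - p\<bar> * \<bar>X (Suc (2 * M - 1)) - p\<bar> \<le> 1"
        using q x eq M by (simp add: q_def mult.commute)
      then show ?thesis using coversI[of "2 * M - 1"] M by simp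
    qed
  qed
qed

section \<open>Reduction of the theorem to the two placements\<close>

lemma eq_one_of_sum_ge:
  fixes f :: "nat \<Rightarrow> nat"
  assumes "finite A" "\<And>i. i \<in> A \<Longrightarrow> f i \<le> 1" "card A \<le> (\<Sum>i\<in>A. f i)" "i \<in> A"
  shows "f i = 1"
proof (rule ccontr)
  assume "f i \<noteq> 1"
  then have "f i < 1" using assms(2)[OF assms(4)] by simp
  then have "(\<Sum>i\<in>A. f i) < (\<Sum>i\<in>A. 1)" using assms by (intro sum_strict_mono_ex1) auto
  then show False using assms(3) by simp
qed

text \<open>If an end zone is empty, balance allows each of the \<open>M\<close> other zones at most
  one receiver; they contain \<open>N \<ge> M\<close> receivers, so each has exactly one. If both
  end zones are nonempty, balance makes the inner ones nonempty.\<close>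

lemma balanced_zones_cases:
  assumes bal: "balanced M n" and M: "1 \<le> M" and sum: "(\<Sum>i\<le>M. n i) = N" "M \<le> N"
  obtains (pos) "\<And>i. i \<le> M \<Longrightarrow> 1 \<le> n i"
  | (first) "N = M" "n 0 = 0" "\<And>i. 1 \<le> i \<Longrightarrow> i \<le> M \<Longrightarrow> n i = 1"
  | (last) "N = M" "n M = 0" "\<And>i. i < M \<Longrightarrow> n i = 1"
proof -
  have split: "n 0 + (\<Sum>i\<in>{1..<M}. n i) + n M = N"
    using sum(1) sum_atMost_split_ends[OF M, of n] by simp
  have ends: "\<bar>int (n i) - 2 * int (n 0)\<bar> \<le> 1" "\<bar>int (n i) - 2 * int (n M)\<bar> \<le> 1"
    if "i \<in> {1..<M}" for i
    using bal that by (auto simp: balanced_def)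
  consider "n 0 = 0" | "n M = 0" | "1 \<le> n 0" "1 \<le> n M" by linarith
  then show ?thesis
  proof cases
    case 1
    have le: "n i \<le> 1" if "i \<in> {1..M}" for i
    proof (cases "i = M")
      case True
      show ?thesis
      proof (cases "M = 1")
        case True
        then show ?thesis using bal 1 \<open>i = M\<close> by (auto simp: balanced_def)
      next
        case False
        \<comment> \<open>Zone 1 links the two ends: as \<open>n 0 = 0\<close> it holds at most one
          receiver, hence \<open>2 * n M\<close> is at most 2.\<close>
        then have "1 \<in> {1..<M}" using M by auto
        from ends[OF this, unfolded 1] \<open>i = M\<close> show ?thesis by simp
      qed
    next
      case False
      then show ?thesis using ends(1)[of i] 1 that by auto
    qed
    have "{1..M} = insert M {1..<M}" using M by auto
    then have s: "(\<Sum>i\<in>{1..M}. n i) = N" using split 1 by simp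
    then have one: "n i = 1" if "i \<in> {1..M}" for i
      using eq_one_of_sum_ge[of "{1..M}" n i] le sum(2) that by simp
    then have "N = M" using s by simp
    then show ?thesis using first 1 one by simp
  next
    case 2
    have le: "n i \<le> 1" if "i \<in> {..<M}" for i
    proof (cases "i = 0")
      case True
      show ?thesis
      proof (cases "M = 1")
        case True
        then show ?thesis using bal 2 \<open>i = 0\<close> by (auto simp: balanced_def)
      next
        case False
        then have "1 \<in> {1..<M}" using M by auto
        from ends[OF this, unfolded 2] \<open>i = 0\<close> show ?thesis by simp
      qed
    next
      case False
      then show ?thesis using ends(2)[of i] 2 that by auto
    qed
    have "{..<M} = insert 0 {1..<M}" using M by auto
    then have s: "(\<Sum>i\<in>{..<M}. n i) = N" using split 2 by simp
    then have one: "n i = 1" if "i \<in> {..<M}" for i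
      using eq_one_of_sum_ge[of "{..<M}" n i] le sum(2) that by simp
    then have "N = M" using s by simp
    then show ?thesis using last 2 one by simp
  next
    case 3
    show ?thesis
    proof (rule pos)
      fix i assume i: "i \<le> M"
      show "1 \<le> n i"
      proof (cases "i \<in> {1..<M}")
        case True
        then show ?thesis using ends[OF True] 3 by linarith
      next
        case False
        then have "i = 0 \<or> i = M" using i by auto
        then show ?thesis using 3 by auto
      qed
    qed
  qed
qed

theorem theorem4:
  fixes M N :: nat and h :: real and S :: "node list"
  assumes "1 \<le> M" and "M \<le> N" and "0 < h"
    and "candidate_order M N S"
    and "\<forall>i \<in> {1..<M}. \<forall>j \<in> {1..<M}. i \<noteq> j \<longrightarrow> \<bar>int (n_mid S i) - int (n_mid S j)\<bar> \<le> 1"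
    and "\<forall>i \<in> {1..<M}. \<bar>int (n_mid S i) - 2 * int (n_first S)\<bar> \<le> 1"
    and "\<forall>i \<in> {1..<M}. \<bar>int (n_mid S i) - 2 * int (n_last M S)\<bar> \<le> 1"
    and "M = 1 \<longrightarrow> \<bar>int (n_first S) - int (n_last M S)\<bar> \<le> 1"
  shows "optimal_order M N h S"
proof -
  note M = \<open>1 \<le> M\<close> and h = \<open>0 < h\<close>
  have dep: "deployment_order M N S" using assms(4) by (simp add: candidate_order_def)
  define n where "n = zone_size M S"
  have bal: "balanced M n"
    using assms by (auto simp: balanced_def n_def zone_size_def)
  obtain T where T0: "T 0 = 0" and TM: "T (M + 1) = M + N + 1"
    and TS: "\<And>i. i \<le> M \<Longrightarrow> T (Suc i) = T i + n i + 1"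
    and TX: "\<And>k. type_of (S ! k) = TX \<and> k < length S \<longleftrightarrow> k \<in> T ` {1..M}"
    and RX: "\<And>k. type_of (S ! k) = RX \<and> k < length S \<longleftrightarrow> 0 < k \<and> k \<le> M + N \<and> k \<notin> T ` {1..M}"
    unfolding n_def using order_positions[OF dep M] by metis
  have "T (Suc m) = (\<Sum>i\<le>m. n i) + m + 1" if "m \<le> M" for m
    using that by (induction m) (simp_all add: TS T0)
  from this[of M] have sum: "(\<Sum>i\<le>M. n i) = N" using TM by simp
  \<comment> \<open>The flag \<open>b\<close> is the parity of the transmitter indices:
    \<open>False\<close> if the order begins with a transmitter, \<open>True\<close> if it begins
    with a receiver.\<close>
  have alternate: "optimal_order M N h S"
    if "N = M" and P: "\<And>k. 0 < k \<Longrightarrow> k \<le> 2 * M \<Longrightarrow> k \<in> T ` {1..M} \<longleftrightarrow> even k = b" for b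
    unfolding \<open>N = M\<close>
  proof (rule alternating_optimal[OF _ M h])
    show "deployment_order M M S" using dep \<open>N = M\<close> by simp
    fix k assume k: "0 < k" "k < 2 * M"
    show "{type_of (S ! k), type_of (S ! Suc k)} = {TX, RX}"
      using TX[of k] RX[of k] TX[of "Suc k"] RX[of "Suc k"] P[of k] P[of "Suc k"] k \<open>N = M\<close>
      by (cases "even k"; cases b) auto
  qed
  show ?thesis
    using bal M sum \<open>M \<le> N\<close>
  proof (cases rule: balanced_zones_cases)
    case pos
    show ?thesis
      by (rule balanced_optimal[OF dep M _ h]) (use bal sum pos assms in \<open>auto simp: n_def\<close>)
  next
    case first
    have T: "T i = 2 * i - 1" if "1 \<le> i" "i \<le> M" for i
      using that
    proof (induction rule: dec_induct)
      case base
      then show ?case using TS[of 0] T0 first by simp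
    next
      case (step i)
      then show ?case using TS[of i] first(3)[of i] by simp
    qed
    have "k \<in> T ` {1..M} \<longleftrightarrow> even k = False" if "0 < k" "k \<le> 2 * M" for k
    proof
      assume "k \<in> T ` {1..M}"
      then show "even k = False" using T by auto
    next
      assume "even k = False"
      then have "k = 2 * (k div 2 + 1) - 1" "k div 2 + 1 \<le> M" using that by presburger+
      then show "k \<in> T ` {1..M}" using T[of "k div 2 + 1"] by (intro image_eqI[of _ _ "k div 2 + 1"]) auto
    qed
    then show ?thesis using alternate first(1) by blast
  next
    case last
    have T: "T i = 2 * i" if "i \<le> M" for i
      using that
    proof (induction i)
      case 0
      then show ?case using T0 by simp
    next
      case (Suc i)
      then show ?case using TS[of i] last(3)[of i] by simp
    qed
    have "k \<in> T ` {1..M} \<longleftrightarrow> even k = True" if "0 < k" "k \<le> 2 * M" for k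
    proof
      assume "k \<in> T ` {1..M}"
      then show "even k = True" using T by auto
    next
      assume "even k = True"
      then have "k = 2 * (k div 2)" "1 \<le> k div 2" "k div 2 \<le> M" using that by presburger+
      then show "k \<in> T ` {1..M}" using T[of "k div 2"] by (intro image_eqI[of _ _ "k div 2"]) auto
    qed
    then show ?thesis using alternate last(1) by blast
  qed
qed

end
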